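(* The variety $\mathcal{V}_{\sigma\mathbb{RS}_u}$ is generated by $\mathbb{R}$: every $G\in\mathcal{V}_{\sigma\mathbb{RS}_u}$ is isomorphic to a subalgebra of a quotient of a power of the algebra $\mathbb{R}$ with its usual Riesz space operations, $\bigvee^-(g,f_1,f_2,\dots)=\sup_{n\ge1}\{f_n\wedge g\}$, and the constant $1$ interpreted as the real number $1$.
   Context: $\mathcal{V}_{\sigma\mathbb{RS}_u}$ is the infinitary variety of algebras with the Riesz space operations ($0,+,-,\vee,\wedge$, $\lambda\cdot-$ for $\lambda\in\mathbb{R}$), a countably infinitary operation $\bigvee^-$ (write $\bigvee_{n\ge1}^g f_n:=\bigvee^-(g,f_1,f_2,\dots)$) and a constant $1$, satisfying the Riesz space axioms, (A1) $\bigvee_{n\ge1}^g f_n=\bigvee_{n\ge1}^g(f_n\wedge g)$; (A2) $\bigvee_{n\ge1}^g f_n=(f_1\wedge g)\vee\bigvee^-(g,f_2,f_3,\dots)$; (A3) $\bigvee_{n\ge1}^g(f_n\wedge h)\le h$ ($a\le b$ meaning $a\wedge b=a$); and $\bigvee_{n\ge1}^{|f|}(|f|\wedge n1)=|f|$. *)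

theory Defs
  imports Complex_Main
begin

text \<open>Algebras in the signature of sigma-Riesz spaces with a unit: a carrier set together with
  the Riesz space operations 0, +, unary -, sup, inf, scalar multiplication, the countably
  infinitary operation bigsup (bigsup g f stands for the join over n of f_n bounded by g,
  with f 0 playing the role of f_1), and the constant 1.\<close>

record 'a srs =
  carrier :: "'a set"
  zero :: 'a
  add :: "'a \<Rightarrow> 'a \<Rightarrow> 'a"
  neg :: "'a \<Rightarrow> 'a"
  sup_op :: "'a \<Rightarrow> 'a \<Rightarrow> 'a"
  inf_op :: "'a \<Rightarrow> 'a \<Rightarrow> 'a"
  smul :: "real \<Rightarrow> 'a \<Rightarrow> 'a"
  bigsup :: "'a \<Rightarrow> (nat \<Rightarrow> 'a) \<Rightarrow> 'a"
  one :: 'a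

definition le_srs :: "'a srs \<Rightarrow> 'a \<Rightarrow> 'a \<Rightarrow> bool" where
  "le_srs A x y \<longleftrightarrow> inf_op A x y = x"

definition abs_srs :: "'a srs \<Rightarrow> 'a \<Rightarrow> 'a" where
  "abs_srs A x = sup_op A x (neg A x)"

definition closed_srs :: "'a srs \<Rightarrow> bool" where
  "closed_srs A \<longleftrightarrow>
     zero A \<in> carrier A \<and> one A \<in> carrier A \<and>
     (\<forall>x\<in>carrier A. \<forall>y\<in>carrier A.
        add A x y \<in> carrier A \<and> sup_op A x y \<in> carrier A \<and> inf_op A x y \<in> carrier A) \<and>
     (\<forall>x\<in>carrier A. neg A x \<in> carrier A) \<and>
     (\<forall>c. \<forall>x\<in>carrier A. smul A c x \<in> carrier A) \<and>
     (\<forall>g\<in>carrier A. \<forall>f. range f \<subseteq> carrier A \<longrightarrow> bigsup A g f \<in> carrier A)"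

definition riesz_space_axioms :: "'a srs \<Rightarrow> bool" where
  "riesz_space_axioms A \<longleftrightarrow>
     (\<forall>x\<in>carrier A. \<forall>y\<in>carrier A. \<forall>z\<in>carrier A.
        add A (add A x y) z = add A x (add A y z) \<and>
        sup_op A (sup_op A x y) z = sup_op A x (sup_op A y z) \<and>
        inf_op A (inf_op A x y) z = inf_op A x (inf_op A y z) \<and>
        (le_srs A x y \<longrightarrow> le_srs A (add A x z) (add A y z))) \<and>
     (\<forall>x\<in>carrier A. \<forall>y\<in>carrier A.
        add A x y = add A y x \<and>
        sup_op A x y = sup_op A y x \<and> inf_op A x y = inf_op A y x \<and>
        sup_op A x (inf_op A x y) = x \<and> inf_op A x (sup_op A x y) = x \<and>
        (\<forall>c. smul A c (add A x y) = add A (smul A c x) (smul A c y)) \<and>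
        (\<forall>c. 0 \<le> c \<longrightarrow> le_srs A x y \<longrightarrow> le_srs A (smul A c x) (smul A c y))) \<and>
     (\<forall>x\<in>carrier A.
        add A x (zero A) = x \<and> add A x (neg A x) = zero A \<and>
        smul A 1 x = x \<and>
        (\<forall>a b. smul A (a + b) x = add A (smul A a x) (smul A b x)) \<and>
        (\<forall>a b. smul A a (smul A b x) = smul A (a * b) x))"

definition in_V :: "'a srs \<Rightarrow> bool" where
  "in_V A \<longleftrightarrow>
     closed_srs A \<and> riesz_space_axioms A \<and>
     (\<forall>g\<in>carrier A. \<forall>f. range f \<subseteq> carrier A \<longrightarrow>
        bigsup A g f = bigsup A g (\<lambda>n. inf_op A (f n) g)) \<and>
     (\<forall>g\<in>carrier A. \<forall>f. range f \<subseteq> carrier A \<longrightarrow>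
        bigsup A g f = sup_op A (inf_op A (f 0) g) (bigsup A g (\<lambda>n. f (Suc n)))) \<and>
     (\<forall>g\<in>carrier A. \<forall>h\<in>carrier A. \<forall>f. range f \<subseteq> carrier A \<longrightarrow>
        le_srs A (bigsup A g (\<lambda>n. inf_op A (f n) h)) h) \<and>
     (\<forall>f\<in>carrier A.
        bigsup A (abs_srs A f) (\<lambda>n. inf_op A (abs_srs A f) (smul A (real (Suc n)) (one A)))
          = abs_srs A f)"

definition real_srs :: "real srs" where
  "real_srs = \<lparr> carrier = UNIV, zero = 0, add = (+), neg = uminus, sup_op = max, inf_op = min,
     smul = (*), bigsup = (\<lambda>g f. (SUP n. min (f n) g)), one = 1 \<rparr>"

definition power_srs :: "('i \<Rightarrow> real) srs" where
  "power_srs = \<lparr> carrier = UNIV, zero = (\<lambda>i. 0), add = (\<lambda>x y i. x i + y i),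
     neg = (\<lambda>x i. - x i), sup_op = (\<lambda>x y i. max (x i) (y i)),
     inf_op = (\<lambda>x y i. min (x i) (y i)), smul = (\<lambda>c x i. c * x i),
     bigsup = (\<lambda>g f i. bigsup real_srs (g i) (\<lambda>n. f n i)), one = (\<lambda>i. 1) \<rparr>"

definition congruence_srs :: "'a srs \<Rightarrow> ('a \<times> 'a) set \<Rightarrow> bool" where
  "congruence_srs A \<theta> \<longleftrightarrow> equiv (carrier A) \<theta> \<and>
     (\<forall>x x' y y'. (x, x') \<in> \<theta> \<longrightarrow> (y, y') \<in> \<theta> \<longrightarrow>
        (add A x y, add A x' y') \<in> \<theta> \<and> (sup_op A x y, sup_op A x' y') \<in> \<theta> \<and>
        (inf_op A x y, inf_op A x' y') \<in> \<theta>) \<and>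
     (\<forall>x x'. (x, x') \<in> \<theta> \<longrightarrow> (neg A x, neg A x') \<in> \<theta> \<and>
        (\<forall>c. (smul A c x, smul A c x') \<in> \<theta>)) \<and>
     (\<forall>g g' f f'. (g, g') \<in> \<theta> \<longrightarrow> (\<forall>n. (f n, f' n) \<in> \<theta>) \<longrightarrow>
        (bigsup A g f, bigsup A g' f') \<in> \<theta>)"

definition rep :: "'a set \<Rightarrow> 'a" where "rep X = (SOME x. x \<in> X)"

definition quotient_srs :: "'a srs \<Rightarrow> ('a \<times> 'a) set \<Rightarrow> 'a set srs" where
  "quotient_srs A \<theta> = \<lparr> carrier = carrier A // \<theta>,
     zero = \<theta> `` {zero A},
     add = (\<lambda>X Y. \<theta> `` {add A (rep X) (rep Y)}),
     neg = (\<lambda>X. \<theta> `` {neg A (rep X)}),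
     sup_op = (\<lambda>X Y. \<theta> `` {sup_op A (rep X) (rep Y)}),
     inf_op = (\<lambda>X Y. \<theta> `` {inf_op A (rep X) (rep Y)}),
     smul = (\<lambda>c X. \<theta> `` {smul A c (rep X)}),
     bigsup = (\<lambda>G F. \<theta> `` {bigsup A (rep G) (\<lambda>n. rep (F n))}),
     one = \<theta> `` {one A} \<rparr>"

definition subalgebra_srs :: "'a srs \<Rightarrow> 'a srs \<Rightarrow> bool" where
  "subalgebra_srs S A \<longleftrightarrow> carrier S \<subseteq> carrier A \<and> closed_srs S \<and>
     zero S = zero A \<and> one S = one A \<and>
     (\<forall>x\<in>carrier S. \<forall>y\<in>carrier S. add S x y = add A x y \<and>
        sup_op S x y = sup_op A x y \<and> inf_op S x y = inf_op A x y) \<and>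
     (\<forall>x\<in>carrier S. neg S x = neg A x \<and> (\<forall>c. smul S c x = smul A c x)) \<and>
     (\<forall>g\<in>carrier S. \<forall>f. range f \<subseteq> carrier S \<longrightarrow> bigsup S g f = bigsup A g f)"

definition hom_srs :: "'a srs \<Rightarrow> 'b srs \<Rightarrow> ('a \<Rightarrow> 'b) \<Rightarrow> bool" where
  "hom_srs A B h \<longleftrightarrow> h ` carrier A \<subseteq> carrier B \<and>
     h (zero A) = zero B \<and> h (one A) = one B \<and>
     (\<forall>x\<in>carrier A. \<forall>y\<in>carrier A. h (add A x y) = add B (h x) (h y) \<and>
        h (sup_op A x y) = sup_op B (h x) (h y) \<and> h (inf_op A x y) = inf_op B (h x) (h y)) \<and>
     (\<forall>x\<in>carrier A. h (neg A x) = neg B (h x) \<and> (\<forall>c. h (smul A c x) = smul B c (h x))) \<and>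
     (\<forall>g\<in>carrier A. \<forall>f. range f \<subseteq> carrier A \<longrightarrow>
        h (bigsup A g f) = bigsup B (h g) (\<lambda>n. h (f n)))"

definition iso_srs :: "'a srs \<Rightarrow> 'b srs \<Rightarrow> ('a \<Rightarrow> 'b) \<Rightarrow> bool" where
  "iso_srs A B h \<longleftrightarrow> hom_srs A B h \<and> bij_betw h (carrier A) (carrier B)"

end

(*
A Rasiowa-Sikorski argument. For countably many instances of the operations and x not below y, some
valuation of G in the reals respects these instances and separates x from y. So if two functions on
the set of all valuations are identified when they agree off a countable union of failure sets of
single instances, evaluation at x is an embedding of G, and the identification respects countable
suprema because countable unions of such unions are again of this form.

For the valuation: G is a Dedekind sigma-complete Riesz space with weak unit 1. A nonzero p >= 0
forces u <= 0 if p is disjoint from the positive part of u. A countable supremum s either has s <= q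
forced by p, or some member is forced to be >= q by a smaller p'; hence a decreasing sequence of such
p can decide countably many suprema at all rational levels q. The forced inequalities are then the
Dedekind cuts of the valuation.
*)

theory Submission
  imports Defs "HOL-Library.Countable_Set"
begin

section \<open>Generic sequences for countably many dense sets\<close>

text \<open>The Rasiowa-Sikorski lemma by dependent choice: the family is enumerated, and step n
  moves from the current condition into the n-th member, which is thus met at index n + 1.\<close>

lemma generic_sequence:
  assumes "countable \<D>" "p0 \<in> K"
    and dense: "\<And>D p. D \<in> \<D> \<Longrightarrow> p \<in> K \<Longrightarrow> \<exists>q \<in> D \<inter> K. R q p"
    and refl: "\<And>p. p \<in> K \<Longrightarrow> R p p"
  obtains p :: "nat \<Rightarrow> 'a" where "p 0 = p0" "\<And>n. p n \<in> K" "\<And>n. R (p (Suc n)) (p n)"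
    "\<And>D. D \<in> \<D> \<Longrightarrow> \<exists>n. p n \<in> D"
proof (cases "\<D> = {}")
  case True
  \<comment> \<open>No set has to be met, so the constant sequence serves; this is where reflexivity
    of \<open>R\<close> enters.\<close>
  show ?thesis
    by (rule that[of "\<lambda>_. p0"]) (use True assms in auto)
next
  case False
  define e where "e = from_nat_into \<D>"
  have e: "range e = \<D>"
    unfolding e_def using False assms(1) by (rule range_from_nat_into)
  have "\<exists>p. \<forall>n. (p n \<in> K \<and> (n = 0 \<longrightarrow> p n = p0)) \<and> (p (Suc n) \<in> e n \<and> R (p (Suc n)) (p n))"
  proof (rule dependent_nat_choice)
    show "\<exists>x. x \<in> K \<and> (0 = (0::nat) \<longrightarrow> x = p0)" using assms(2) by auto
    show "\<exists>y. (y \<in> K \<and> (Suc n = 0 \<longrightarrow> y = p0)) \<and> y \<in> e n \<and> R y x"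
      if "x \<in> K \<and> (n = 0 \<longrightarrow> x = p0)" for x n
      using dense[of "e n" x] that e by auto
  qed
  then obtain p where p: "\<forall>n. (p n \<in> K \<and> (n = 0 \<longrightarrow> p n = p0)) \<and> (p (Suc n) \<in> e n \<and> R (p (Suc n)) (p n))"
    by blast
  show ?thesis
  proof (rule that[of p])
    show "\<exists>n. p n \<in> D" if "D \<in> \<D>" for D
      using that p e by (metis imageE)
  qed (use p in auto)
qed

section \<open>Algebras of the variety: notation and axioms\<close>

locale sigma_riesz =
  fixes G :: "'a srs"
  assumes V: "in_V G"
begin

abbreviation C where "C \<equiv> carrier G"
abbreviation plus_G (infixl "\<oplus>" 65) where "x \<oplus> y \<equiv> add G x y"
abbreviation neg_G ("\<ominus> _" [81] 80) where "\<ominus> x \<equiv> neg G x"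
abbreviation join_G (infixl "\<squnion>" 65) where "x \<squnion> y \<equiv> sup_op G x y"
abbreviation meet_G (infixl "\<sqinter>" 70) where "x \<sqinter> y \<equiv> inf_op G x y"
abbreviation scale_G (infixr "\<cdot>" 75) where "c \<cdot> x \<equiv> smul G c x"
abbreviation le_G (infix "\<preceq>" 50) where "x \<preceq> y \<equiv> le_srs G x y"
abbreviation zero_G ("\<zero>") where "\<zero> \<equiv> zero G"
abbreviation one_G ("\<one>") where "\<one> \<equiv> one G"

lemmas closed_G = V[unfolded in_V_def, THEN conjunct1]
lemmas riesz_G = V[unfolded in_V_def, THEN conjunct2, THEN conjunct1]
lemmas A1 = V[unfolded in_V_def, THEN conjunct2, THEN conjunct2, THEN conjunct1, rule_format]
lemmas A2 = V[unfolded in_V_def, THEN conjunct2, THEN conjunct2, THEN conjunct2, THEN conjunct1,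
    rule_format]
lemmas A3 = V[unfolded in_V_def, THEN conjunct2, THEN conjunct2, THEN conjunct2, THEN conjunct2,
    THEN conjunct1, rule_format]
lemmas unit = V[unfolded in_V_def, THEN conjunct2, THEN conjunct2, THEN conjunct2, THEN conjunct2,
    THEN conjunct2, rule_format]

lemma closed [simp, intro]:
  "\<zero> \<in> C" "\<one> \<in> C"
  "x \<in> C \<Longrightarrow> y \<in> C \<Longrightarrow> x \<oplus> y \<in> C"
  "x \<in> C \<Longrightarrow> y \<in> C \<Longrightarrow> x \<squnion> y \<in> C"
  "x \<in> C \<Longrightarrow> y \<in> C \<Longrightarrow> x \<sqinter> y \<in> C"
  "x \<in> C \<Longrightarrow> \<ominus> x \<in> C"
  "x \<in> C \<Longrightarrow> c \<cdot> x \<in> C"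
  using closed_G unfolding closed_srs_def by auto

lemma bigsup_closed [simp]: "g \<in> C \<Longrightarrow> (\<And>n. f n \<in> C) \<Longrightarrow> bigsup G g f \<in> C"
  using closed_G unfolding closed_srs_def image_subset_iff by simp

lemma add_assoc: "x \<in> C \<Longrightarrow> y \<in> C \<Longrightarrow> z \<in> C \<Longrightarrow> x \<oplus> y \<oplus> z = x \<oplus> (y \<oplus> z)"
  and sup_assoc: "x \<in> C \<Longrightarrow> y \<in> C \<Longrightarrow> z \<in> C \<Longrightarrow> x \<squnion> y \<squnion> z = x \<squnion> (y \<squnion> z)"
  and inf_assoc: "x \<in> C \<Longrightarrow> y \<in> C \<Longrightarrow> z \<in> C \<Longrightarrow> x \<sqinter> y \<sqinter> z = x \<sqinter> (y \<sqinter> z)"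
  and add_right_mono: "x \<preceq> y \<Longrightarrow> x \<in> C \<Longrightarrow> y \<in> C \<Longrightarrow> z \<in> C \<Longrightarrow> x \<oplus> z \<preceq> y \<oplus> z"
  and add_comm: "x \<in> C \<Longrightarrow> y \<in> C \<Longrightarrow> x \<oplus> y = y \<oplus> x"
  and sup_comm: "x \<in> C \<Longrightarrow> y \<in> C \<Longrightarrow> x \<squnion> y = y \<squnion> x"
  and inf_comm: "x \<in> C \<Longrightarrow> y \<in> C \<Longrightarrow> x \<sqinter> y = y \<sqinter> x"
  and sup_inf_absorb: "x \<in> C \<Longrightarrow> y \<in> C \<Longrightarrow> x \<squnion> x \<sqinter> y = x"
  and inf_sup_absorb: "x \<in> C \<Longrightarrow> y \<in> C \<Longrightarrow> x \<sqinter> (x \<squnion> y) = x"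
  and scale_add: "x \<in> C \<Longrightarrow> y \<in> C \<Longrightarrow> c \<cdot> (x \<oplus> y) = c \<cdot> x \<oplus> c \<cdot> y"
  and scale_mono: "x \<preceq> y \<Longrightarrow> x \<in> C \<Longrightarrow> y \<in> C \<Longrightarrow> 0 \<le> c \<Longrightarrow> c \<cdot> x \<preceq> c \<cdot> y"
  and add_zero [simp]: "x \<in> C \<Longrightarrow> x \<oplus> \<zero> = x"
  and add_neg [simp]: "x \<in> C \<Longrightarrow> x \<oplus> \<ominus> x = \<zero>"
  and scale_one [simp]: "x \<in> C \<Longrightarrow> 1 \<cdot> x = x"
  and add_scale: "x \<in> C \<Longrightarrow> (a + b) \<cdot> x = a \<cdot> x \<oplus> b \<cdot> x"
  and scale_scale: "x \<in> C \<Longrightarrow> a \<cdot> b \<cdot> x = (a * b) \<cdot> x"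
  using riesz_G unfolding riesz_space_axioms_def by blast+

section \<open>The lattice order\<close>

text \<open>Idempotence of the meet follows from the two absorption laws: joining
  \<open>x \<sqinter> x\<close> to \<open>x\<close> gives \<open>x\<close>, and meeting the result
  with \<open>x\<close> gives \<open>x\<close> again.\<close>

lemma le_refl [simp, intro]: "x \<in> C \<Longrightarrow> x \<preceq> x"
  using inf_sup_absorb[of x "x \<sqinter> x"] sup_inf_absorb[of x x] unfolding le_srs_def by simp

lemma le_trans: "x \<preceq> y \<Longrightarrow> y \<preceq> z \<Longrightarrow> x \<in> C \<Longrightarrow> y \<in> C \<Longrightarrow> z \<in> C \<Longrightarrow> x \<preceq> z"
  unfolding le_srs_def by (metis inf_assoc)

lemma le_antisym: "x \<preceq> y \<Longrightarrow> y \<preceq> x \<Longrightarrow> x \<in> C \<Longrightarrow> y \<in> C \<Longrightarrow> x = y"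
  unfolding le_srs_def by (metis inf_comm)

lemma inf_le1 [simp, intro]: "x \<in> C \<Longrightarrow> y \<in> C \<Longrightarrow> x \<sqinter> y \<preceq> x"
  using le_refl[of x] inf_comm[of "x \<sqinter> y" x] unfolding le_srs_def by (simp flip: inf_assoc)

lemma inf_le2 [simp, intro]: "x \<in> C \<Longrightarrow> y \<in> C \<Longrightarrow> x \<sqinter> y \<preceq> y"
  using inf_le1[of y x] by (simp add: inf_comm)

lemma inf_greatest: "z \<preceq> x \<Longrightarrow> z \<preceq> y \<Longrightarrow> x \<in> C \<Longrightarrow> y \<in> C \<Longrightarrow> z \<in> C \<Longrightarrow> z \<preceq> x \<sqinter> y"
  unfolding le_srs_def by (simp flip: inf_assoc)

lemma sup_ge1 [simp, intro]: "x \<in> C \<Longrightarrow> y \<in> C \<Longrightarrow> x \<preceq> x \<squnion> y"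
  unfolding le_srs_def by (rule inf_sup_absorb)

lemma sup_ge2 [simp, intro]: "x \<in> C \<Longrightarrow> y \<in> C \<Longrightarrow> y \<preceq> x \<squnion> y"
  using sup_ge1[of y x] by (simp add: sup_comm)

lemma sup_least:
  assumes "x \<preceq> z" "y \<preceq> z" "x \<in> C" "y \<in> C" "z \<in> C"
  shows "x \<squnion> y \<preceq> z"
proof -
  \<comment> \<open>The order is defined by meets; absorption turns it into its join form.\<close>
  have absorb: "u \<squnion> z = z" if "u \<preceq> z" "u \<in> C" for u
    using that assms(5) sup_inf_absorb[of z u] unfolding le_srs_def by (simp add: sup_comm inf_comm)
  have "x \<squnion> y \<squnion> z = z"
    using assms by (simp add: sup_assoc absorb)
  then show ?thesis
    unfolding le_srs_def using inf_sup_absorb[of "x \<squnion> y" z] assms by simp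
qed

section \<open>Ordered vector space arithmetic\<close>

lemma add_left_comm: "x \<in> C \<Longrightarrow> y \<in> C \<Longrightarrow> z \<in> C \<Longrightarrow> x \<oplus> (y \<oplus> z) = y \<oplus> (x \<oplus> z)"
  using add_comm[of x y] by (simp flip: add_assoc)

lemmas add_ac = add_assoc add_comm add_left_comm

lemma zero_add [simp]: "x \<in> C \<Longrightarrow> \<zero> \<oplus> x = x"
  by (simp add: add_comm[of \<zero>])

lemma neg_add_self [simp]: "x \<in> C \<Longrightarrow> \<ominus> x \<oplus> x = \<zero>"
  by (simp add: add_comm[of "\<ominus> x"])

lemma add_neg_cancel [simp]:
  assumes "x \<in> C" "y \<in> C"
  shows "y \<oplus> x \<oplus> \<ominus> x = y" "y \<oplus> \<ominus> x \<oplus> x = y"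
  using assms by (simp_all add: add_assoc)

lemma neg_unique:
  assumes "x \<oplus> y = \<zero>" "x \<in> C" "y \<in> C"
  shows "\<ominus> x = y"
proof -
  have "\<ominus> x \<oplus> (x \<oplus> y) = y" using assms(2,3) by (simp flip: add_assoc)
  then show ?thesis using assms by simp
qed

lemma neg_neg [simp]: "x \<in> C \<Longrightarrow> \<ominus> (\<ominus> x) = x"
  by (rule neg_unique) auto

lemma neg_zero [simp]: "\<ominus> \<zero> = \<zero>"
  by (rule neg_unique) auto

lemma neg_add: "x \<in> C \<Longrightarrow> y \<in> C \<Longrightarrow> \<ominus> (x \<oplus> y) = \<ominus> x \<oplus> \<ominus> y"
  by (rule neg_unique) (auto simp: add_left_comm[of _ "\<ominus> x"] add_assoc)

lemma add_le_cancel: "x \<in> C \<Longrightarrow> y \<in> C \<Longrightarrow> z \<in> C \<Longrightarrow> x \<oplus> z \<preceq> y \<oplus> z \<longleftrightarrow> x \<preceq> y"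
  using add_right_mono[of x y z] add_right_mono[of "x \<oplus> z" "y \<oplus> z" "\<ominus> z"] by auto

lemma diff_le_iff: "x \<in> C \<Longrightarrow> u \<in> C \<Longrightarrow> v \<in> C \<Longrightarrow> x \<oplus> \<ominus> v \<preceq> u \<longleftrightarrow> x \<preceq> u \<oplus> v"
  using add_le_cancel[of "x \<oplus> \<ominus> v" u v] by simp

lemma le_diff_iff: "x \<in> C \<Longrightarrow> u \<in> C \<Longrightarrow> v \<in> C \<Longrightarrow> u \<preceq> x \<oplus> \<ominus> v \<longleftrightarrow> u \<oplus> v \<preceq> x"
  using add_le_cancel[of u "x \<oplus> \<ominus> v" v] by simp

lemma add_mono:
  assumes "a \<preceq> b" "c \<preceq> d" "a \<in> C" "b \<in> C" "c \<in> C" "d \<in> C"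
  shows "a \<oplus> c \<preceq> b \<oplus> d"
proof (rule le_trans)
  show "a \<oplus> c \<preceq> b \<oplus> c" using assms by (simp add: add_right_mono)
  show "b \<oplus> c \<preceq> b \<oplus> d" using assms add_right_mono[of c d b] by (simp add: add_comm)
qed (use assms in auto)

lemma neg_antimono:
  assumes "x \<preceq> y" "x \<in> C" "y \<in> C"
  shows "\<ominus> y \<preceq> \<ominus> x"
  using assms diff_le_iff[of \<zero> "\<ominus> x" y] le_diff_iff[of y \<zero> x] by (simp add: add_comm)

lemma zero_le_diff: "x \<in> C \<Longrightarrow> y \<in> C \<Longrightarrow> \<zero> \<preceq> x \<oplus> \<ominus> y \<longleftrightarrow> y \<preceq> x"
  by (simp add: le_diff_iff)

lemma diff_le_self:
  assumes "\<zero> \<preceq> v" "x \<in> C" "v \<in> C"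
  shows "x \<oplus> \<ominus> v \<preceq> x"
  using assms add_mono[of x x \<zero> v] by (simp add: diff_le_iff)

text \<open>The closing move of several arguments below: if subtracting \<open>w\<close> from a
  least bound \<open>x\<close> still leaves a bound, then \<open>w\<close> is at most zero.\<close>

lemma le_diff_selfD: "x \<preceq> x \<oplus> \<ominus> w \<Longrightarrow> x \<in> C \<Longrightarrow> w \<in> C \<Longrightarrow> w \<preceq> \<zero>"
  using add_le_cancel[of w \<zero> x] by (simp add: le_diff_iff add_comm)

lemma zero_scale [simp]: "x \<in> C \<Longrightarrow> 0 \<cdot> x = \<zero>"
  using add_scale[of x 0 0] add_neg_cancel(1)[of "0 \<cdot> x" "0 \<cdot> x"] by simp

lemma scale_zero [simp]: "c \<cdot> \<zero> = \<zero>"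
  using zero_scale[of \<zero>] scale_scale[of \<zero> c 0] by simp

lemma minus_scale: "x \<in> C \<Longrightarrow> (- c) \<cdot> x = \<ominus> (c \<cdot> x)"
  using neg_unique[of "c \<cdot> x" "(- c) \<cdot> x"] by (simp flip: add_scale)

lemma scale_neg: "x \<in> C \<Longrightarrow> c \<cdot> (\<ominus> x) = \<ominus> (c \<cdot> x)"
  using neg_unique[of "c \<cdot> x" "c \<cdot> (\<ominus> x)"] by (simp flip: scale_add)

lemma scale_nonneg: "\<zero> \<preceq> x \<Longrightarrow> x \<in> C \<Longrightarrow> 0 \<le> c \<Longrightarrow> \<zero> \<preceq> c \<cdot> x"
  using scale_mono[of \<zero> x c] by simp

lemma scale_right_mono:
  assumes "\<zero> \<preceq> x" "x \<in> C" "c \<le> d"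
  shows "c \<cdot> x \<preceq> d \<cdot> x"
  using scale_nonneg[of x "d - c"] add_scale[of x d "- c"] assms
  by (simp add: minus_scale zero_le_diff)

lemma neg_inf:
  assumes "x \<in> C" "y \<in> C"
  shows "\<ominus> (x \<sqinter> y) = \<ominus> x \<squnion> \<ominus> y"
proof (rule le_antisym)
  have "\<ominus> (\<ominus> x \<squnion> \<ominus> y) \<preceq> x \<sqinter> y"
    using neg_antimono[of "\<ominus> x" "\<ominus> x \<squnion> \<ominus> y"] neg_antimono[of "\<ominus> y" "\<ominus> x \<squnion> \<ominus> y"] assms
    by (intro inf_greatest) auto
  then show "\<ominus> (x \<sqinter> y) \<preceq> \<ominus> x \<squnion> \<ominus> y"
    using neg_antimono[of "\<ominus> (\<ominus> x \<squnion> \<ominus> y)" "x \<sqinter> y"] assms by auto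
qed (use assms in \<open>auto intro!: sup_least neg_antimono\<close>)

lemma sup_add:
  assumes "x \<in> C" "y \<in> C" "z \<in> C"
  shows "x \<squnion> y \<oplus> z = (x \<oplus> z) \<squnion> (y \<oplus> z)"
proof (rule le_antisym)
  have "x \<squnion> y \<preceq> ((x \<oplus> z) \<squnion> (y \<oplus> z)) \<oplus> \<ominus> z"
    by (rule sup_least) (use assms in \<open>auto simp: le_diff_iff\<close>)
  then show "x \<squnion> y \<oplus> z \<preceq> (x \<oplus> z) \<squnion> (y \<oplus> z)"
    using assms by (simp add: le_diff_iff)
  show "(x \<oplus> z) \<squnion> (y \<oplus> z) \<preceq> x \<squnion> y \<oplus> z"
    by (rule sup_least) (use assms in \<open>auto intro!: add_right_mono\<close>)
qed (use assms in auto)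

section \<open>Countable suprema and the Archimedean property\<close>

definition lub :: "(nat \<Rightarrow> 'a) \<Rightarrow> 'a \<Rightarrow> bool" where
  "lub f s \<longleftrightarrow> range f \<subseteq> C \<and> s \<in> C \<and> (\<forall>n. f n \<preceq> s) \<and> (\<forall>h\<in>C. (\<forall>n. f n \<preceq> h) \<longrightarrow> s \<preceq> h)"

text \<open>(A1) to (A3) characterise the operation as a true supremum of the truncated sequence:
  unrolling (A2) n times exhibits the n-th member below it, and (A1) with (A3) gives leastness. This
  is Dedekind sigma-completeness.\<close>

lemma lub_bigsup:
  assumes g: "g \<in> C" and f: "\<And>n. f n \<in> C"
  shows "lub (\<lambda>n. f n \<sqinter> g) (bigsup G g f)"
proof -
  have fC: "range f \<subseteq> C" using f by auto
  have upper: "f n \<sqinter> g \<preceq> bigsup G g f" for n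
    using f
  proof (induction n arbitrary: f)
    case 0
    have "bigsup G g f = (f 0 \<sqinter> g) \<squnion> bigsup G g (\<lambda>n. f (Suc n))"
      by (rule A2) (use 0 g in auto)
    then show ?case using 0 g by (simp only:) (intro sup_ge1, auto)
  next
    case (Suc n)
    have "bigsup G g f = (f 0 \<sqinter> g) \<squnion> bigsup G g (\<lambda>n. f (Suc n))"
      by (rule A2) (use Suc g in auto)
    moreover have "f (Suc n) \<sqinter> g \<preceq> bigsup G g (\<lambda>n. f (Suc n))"
      using Suc.IH[of "\<lambda>n. f (Suc n)"] Suc.prems by auto
    moreover have "bigsup G g (\<lambda>n. f (Suc n)) \<preceq> (f 0 \<sqinter> g) \<squnion> bigsup G g (\<lambda>n. f (Suc n))"
      using Suc.prems g by (intro sup_ge2) auto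
    ultimately show ?case
      using le_trans[of "f (Suc n) \<sqinter> g" "bigsup G g (\<lambda>n. f (Suc n))" "bigsup G g f"] Suc.prems g
      by simp
  qed
  have least: "bigsup G g f \<preceq> h" if "h \<in> C" "\<And>n. f n \<sqinter> g \<preceq> h" for h
  proof -
    \<comment> \<open>Each truncated member is already below \<open>h\<close>, so meeting with
      \<open>h\<close> changes nothing and (A3) becomes applicable.\<close>
    have "(\<lambda>n. f n \<sqinter> g) = (\<lambda>n. f n \<sqinter> g \<sqinter> h)"
      using that(2) unfolding le_srs_def by simp
    moreover have "bigsup G g (\<lambda>n. f n \<sqinter> g \<sqinter> h) \<preceq> h"
      using f g that by (intro A3) auto
    ultimately show ?thesis using A1[OF g fC] by simp
  qed
  show ?thesis
    unfolding lub_def using upper least f g by auto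
qed

text \<open>Let s be the supremum of all multiples of \<open>w\<close>. Since each (n +
  1)\<open>w\<close> is below s, the element s - \<open>w\<close> also bounds all multiples, so s
  \<le> s - \<open>w\<close>.\<close>

lemma archimedean:
  assumes w: "w \<in> C" and y: "y \<in> C" and le: "\<And>n. real n \<cdot> w \<preceq> y"
  shows "w \<preceq> \<zero>"
proof -
  let ?s = "bigsup G y (\<lambda>n. real n \<cdot> w)"
  have "lub (\<lambda>n. real n \<cdot> w \<sqinter> y) ?s"
    by (rule lub_bigsup) (use w y in auto)
  then have lub: "lub (\<lambda>n. real n \<cdot> w) ?s"
    using le unfolding le_srs_def by simp
  have "real n \<cdot> w \<preceq> ?s \<oplus> \<ominus> w" for n
  proof -
    have "real (Suc n) \<cdot> w \<preceq> ?s" using lub unfolding lub_def by blast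
    then show ?thesis
      using w y add_scale[of w "real n" 1] by (simp add: le_diff_iff add.commute)
  qed
  then have "?s \<preceq> ?s \<oplus> \<ominus> w" using lub w y unfolding lub_def by simp
  then show ?thesis by (rule le_diff_selfD) (use w y in simp_all)
qed

section \<open>Disjoint elements\<close>

text \<open>For the meet w of \<open>x\<close> with the sum, w - \<open>v\<close> lies below both
  \<open>x\<close> and \<open>u\<close>, hence below zero; so w lies below both \<open>x\<close> and
  \<open>v\<close>, and is itself at most zero.\<close>

lemma disjoint_add:
  assumes "x \<sqinter> u = \<zero>" "x \<sqinter> v = \<zero>" "\<zero> \<preceq> v" "\<zero> \<preceq> u" "x \<in> C" "u \<in> C" "v \<in> C"
  shows "x \<sqinter> (u \<oplus> v) = \<zero>"
proof -
  let ?w = "x \<sqinter> (u \<oplus> v)"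
  have x0: "\<zero> \<preceq> x" using inf_le1[of x u] assms by simp
  have w: "?w \<in> C" using assms by simp
  have "?w \<oplus> \<ominus> v \<preceq> x"
    using diff_le_self[of v ?w] assms le_trans[of "?w \<oplus> \<ominus> v" ?w x] by simp
  moreover have "?w \<oplus> \<ominus> v \<preceq> u" using assms by (simp add: diff_le_iff)
  ultimately have "?w \<oplus> \<ominus> v \<preceq> \<zero>"
    using inf_greatest[of "?w \<oplus> \<ominus> v" x u] assms by simp
  then have "?w \<preceq> v" using assms by (simp add: diff_le_iff)
  then have "?w \<preceq> \<zero>"
    using inf_greatest[of ?w x v] assms by simp
  moreover have "\<zero> \<preceq> ?w"
    using add_mono[of \<zero> u \<zero> v] assms x0 by (intro inf_greatest) auto
  ultimately show ?thesis using w by (intro le_antisym) auto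
qed

lemma disjoint_mono:
  assumes "p \<sqinter> u = \<zero>" "\<zero> \<preceq> v" "v \<preceq> u" "\<zero> \<preceq> q" "q \<preceq> p"
    "p \<in> C" "q \<in> C" "u \<in> C" "v \<in> C"
  shows "q \<sqinter> v = \<zero>"
proof (rule le_antisym)
  have "q \<sqinter> v \<preceq> p" by (rule le_trans[of _ q]) (use assms in auto)
  moreover have "q \<sqinter> v \<preceq> u" by (rule le_trans[of _ v]) (use assms in auto)
  ultimately have "q \<sqinter> v \<preceq> p \<sqinter> u" using assms by (intro inf_greatest) auto
  then show "q \<sqinter> v \<preceq> \<zero>" using assms by simp
qed (use assms in \<open>auto intro!: inf_greatest\<close>)

text \<open>Natural multiples come from \<open>disjoint_add\<close> by induction; a real multiple
  lies below some natural one.\<close>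

lemma disjoint_scale:
  assumes "p \<sqinter> u = \<zero>" "\<zero> \<preceq> u" "\<zero> \<preceq> p" "p \<in> C" "u \<in> C" "0 \<le> c"
  shows "p \<sqinter> c \<cdot> u = \<zero>"
proof -
  have nat: "p \<sqinter> real n \<cdot> u = \<zero>" for n
  proof (induction n)
    case 0
    then show ?case using assms(3-5) inf_comm[of p \<zero>] by (simp add: le_srs_def)
  next
    case (Suc n)
    have "real (Suc n) \<cdot> u = real n \<cdot> u \<oplus> u"
      using assms add_scale[of u "real n" 1] by (simp add: add.commute)
    moreover have "p \<sqinter> (real n \<cdot> u \<oplus> u) = \<zero>"
      by (rule disjoint_add) (use Suc assms in \<open>simp_all add: scale_nonneg\<close>)
    ultimately show ?case by simp
  qed
  obtain n where "c \<le> real n" using real_arch_simple by blast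
  then show ?thesis
    by (intro disjoint_mono[OF nat[of n]]) (use assms in \<open>simp_all add: scale_nonneg scale_right_mono\<close>)
qed

lemma le_of_disjoint:
  assumes "x \<preceq> u \<oplus> v" "x \<sqinter> u = \<zero>" "\<zero> \<preceq> v" "x \<in> C" "u \<in> C" "v \<in> C"
  shows "x \<preceq> v"
proof -
  have "x \<oplus> \<ominus> v \<preceq> x \<sqinter> u"
    using assms by (intro inf_greatest diff_le_self) (auto simp: diff_le_iff)
  then show ?thesis using assms by (simp add: diff_le_iff)
qed

text \<open>The sum of disjoint elements is their join: \<open>f\<close> + \<open>w\<close> -
  \<open>s\<close> is below \<open>f\<close> because \<open>w\<close> \<le> \<open>s\<close>, and
  below \<open>w\<close> because \<open>f\<close> \<le> \<open>s\<close>.\<close>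

lemma disjoint_add_le:
  assumes "f \<sqinter> w = \<zero>" "f \<preceq> s" "w \<preceq> s" "f \<in> C" "w \<in> C" "s \<in> C"
  shows "f \<oplus> w \<preceq> s"
proof -
  have "f \<oplus> w \<oplus> \<ominus> s \<preceq> f \<sqinter> w"
    using assms add_mono[of f f w s] add_mono[of f s w w]
    by (intro inf_greatest) (simp_all add: diff_le_iff add_comm[of w s])
  then show ?thesis using assms by (simp add: diff_le_iff)
qed

subsection \<open>Forcing\<close>

abbreviation pos :: "'a \<Rightarrow> 'a" where "pos u \<equiv> u \<squnion> \<zero>"

text \<open>A positive element \<open>p\<close> plays the role of its support; \<open>forces p u\<close> says
  that \<open>u \<le> 0\<close> holds on the support of \<open>p\<close>.\<close>
definition forces :: "'a \<Rightarrow> 'a \<Rightarrow> bool" where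
  "forces p u \<longleftrightarrow> u \<in> C \<and> p \<sqinter> pos u = \<zero>"

text \<open>The forcing conditions. Smaller elements are stronger: they have smaller support and
  force more.\<close>

definition conds :: "'a set" where
  "conds = {p \<in> C. \<zero> \<preceq> p \<and> p \<noteq> \<zero>}"

lemma forces_mono:
  assumes "forces p u" "v \<preceq> u" "v \<in> C" "p \<in> C" "q \<in> C" "\<zero> \<preceq> q" "q \<preceq> p"
  shows "forces q v"
proof -
  have u: "u \<in> C" using assms unfolding forces_def by simp
  have "pos v \<preceq> pos u" using assms u le_trans[of v u "pos u"] by (intro sup_least) auto
  then show ?thesis
    unfolding forces_def using assms u disjoint_mono[of p "pos u" "pos v" q]
    by (auto simp: forces_def)
qed

text \<open>The positive part is subadditive, which reduces the claim to
  \<open>disjoint_add\<close>. The next two lemmas similarly bound a positive part, by the sum and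
  by a multiple of positive parts.\<close>

lemma forces_add:
  assumes "forces p u" "forces p v" "p \<in> C"
  shows "forces p (u \<oplus> v)"
proof -
  have uv: "u \<in> C" "v \<in> C" using assms unfolding forces_def by auto
  have p: "\<zero> \<preceq> p" using assms(1) inf_le1[of p "pos u"] assms uv unfolding forces_def by simp
  have disj: "p \<sqinter> (pos u \<oplus> pos v) = \<zero>"
    using assms uv by (intro disjoint_add) (auto simp: forces_def)
  have "pos (u \<oplus> v) \<preceq> pos u \<oplus> pos v"
    using uv add_mono[of u "pos u" v "pos v"] add_mono[of \<zero> "pos u" \<zero> "pos v"]
    by (intro sup_least) auto
  then show ?thesis
    unfolding forces_def using uv p assms(3) disjoint_mono[OF disj, of "pos (u \<oplus> v)" p] by auto
qed

lemma forces_sup: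
  assumes "forces p u" "forces p v" "p \<in> C"
  shows "forces p (u \<squnion> v)"
proof -
  have uv: "u \<in> C" "v \<in> C" using assms unfolding forces_def by auto
  have p: "\<zero> \<preceq> p" using assms(1) inf_le1[of p "pos u"] assms uv unfolding forces_def by simp
  have disj: "p \<sqinter> (pos u \<oplus> pos v) = \<zero>"
    using assms uv by (intro disjoint_add) (auto simp: forces_def)
  have "pos u \<preceq> pos u \<oplus> pos v" "pos v \<preceq> pos u \<oplus> pos v"
    using uv add_mono[of "pos u" "pos u" \<zero> "pos v"] add_mono[of \<zero> "pos u" "pos v" "pos v"] by auto
  then have "pos (u \<squnion> v) \<preceq> pos u \<oplus> pos v"
    using uv le_trans[of u "pos u" "pos u \<oplus> pos v"] le_trans[of v "pos v" "pos u \<oplus> pos v"]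
      le_trans[of \<zero> "pos v" "pos u \<oplus> pos v"]
    by (intro sup_least) auto
  then show ?thesis
    unfolding forces_def using uv p assms(3) disjoint_mono[OF disj, of "pos (u \<squnion> v)" p] by auto
qed

lemma forces_scale:
  assumes "forces p u" "p \<in> C" "0 \<le> c"
  shows "forces p (c \<cdot> u)"
proof -
  have u: "u \<in> C" using assms unfolding forces_def by auto
  have p: "\<zero> \<preceq> p" using assms(1) inf_le1[of p "pos u"] assms u unfolding forces_def by simp
  have disj: "p \<sqinter> c \<cdot> pos u = \<zero>"
    using assms u p by (intro disjoint_scale) (auto simp: forces_def)
  have "pos (c \<cdot> u) \<preceq> c \<cdot> pos u"
    using u assms(3) by (intro sup_least) (auto intro: scale_mono scale_nonneg)
  then show ?thesis
    unfolding forces_def using u p assms(2) disjoint_mono[OF disj, of "pos (c \<cdot> u)" p] by auto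
qed

text \<open>Positive and negative parts are disjoint: if w is their meet, \<open>pos u\<close> - w
  is still above both \<open>u\<close> and zero, hence above \<open>pos u\<close>.\<close>

lemma forces_pos_neg:
  assumes "u \<in> C"
  shows "forces (pos u) (\<ominus> u)"
proof -
  let ?w = "pos u \<sqinter> pos (\<ominus> u)"
  have eq: "pos u \<oplus> \<ominus> u = pos (\<ominus> u)"
    using assms sup_add[of u \<zero> "\<ominus> u"] by (simp add: sup_comm)
  have "?w \<preceq> pos u \<oplus> \<ominus> u" using assms by (simp add: eq)
  then have "u \<preceq> pos u \<oplus> \<ominus> ?w" using assms by (simp add: le_diff_iff add_comm[of u])
  moreover have "\<zero> \<preceq> pos u \<oplus> \<ominus> ?w" using assms by (simp add: zero_le_diff)
  ultimately have "pos u \<preceq> pos u \<oplus> \<ominus> ?w" using assms by (intro sup_least) auto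
  then have "?w \<preceq> \<zero>" by (rule le_diff_selfD) (use assms in simp_all)
  moreover have "\<zero> \<preceq> ?w" using assms by (intro inf_greatest) auto
  ultimately show ?thesis
    unfolding forces_def using assms by (auto intro: le_antisym)
qed

text \<open>Infinite distributivity in forcing form. With w the meet of \<open>p\<close> and
  \<open>pos s\<close>, each positive part of \<open>f n\<close> is disjoint from w and both lie
  below \<open>pos s\<close>; so \<open>pos s\<close> - w bounds every \<open>f n\<close>, hence
  \<open>s\<close>, and w vanishes.\<close>

lemma forces_lub:
  assumes lub: "lub f s" and forces: "\<And>n. forces p (f n)" and p: "p \<in> C"
  shows "forces p s"
proof -
  have s: "s \<in> C" and f: "\<And>n. f n \<in> C" and up: "\<And>n. f n \<preceq> s"
    and least: "\<And>h. h \<in> C \<Longrightarrow> (\<And>n. f n \<preceq> h) \<Longrightarrow> s \<preceq> h"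
    using lub unfolding lub_def by auto
  have p0: "\<zero> \<preceq> p"
    using forces[of 0] inf_le1[of p "pos (f 0)"] p f unfolding forces_def by simp
  let ?w = "p \<sqinter> pos s"
  have w: "?w \<in> C" "\<zero> \<preceq> ?w" "?w \<preceq> p" using p s p0 by (auto intro!: inf_greatest)
  have "f n \<preceq> pos s \<oplus> \<ominus> ?w" for n
  proof -
    have "pos (f n) \<oplus> ?w \<preceq> pos s"
    proof (rule disjoint_add_le)
      have "?w \<sqinter> pos (f n) = \<zero>"
        by (rule disjoint_mono[of p "pos (f n)"]) (use forces[of n] f[of n] p w in \<open>simp_all add: forces_def\<close>)
      then show "pos (f n) \<sqinter> ?w = \<zero>" using f p s inf_comm[of ?w "pos (f n)"] by simp
      show "pos (f n) \<preceq> pos s"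
        using up[of n] f[of n] s le_trans[of "f n" s "pos s"] by (intro sup_least) auto
    qed (use f p s in auto)
    then have "pos (f n) \<preceq> pos s \<oplus> \<ominus> ?w" using f w s by (simp add: le_diff_iff)
    from le_trans[OF sup_ge1 this] show ?thesis using f p s by simp
  qed
  then have "s \<preceq> pos s \<oplus> \<ominus> ?w" by (rule least[rotated]) (use p s in simp)
  moreover have "\<zero> \<preceq> pos s \<oplus> \<ominus> ?w" using p s by (simp add: zero_le_diff)
  ultimately have "pos s \<preceq> pos s \<oplus> \<ominus> ?w" using p s by (intro sup_least) auto
  then have "?w \<preceq> \<zero>" by (rule le_diff_selfD) (use p s in simp_all)
  then show ?thesis
    unfolding forces_def using w s by (simp add: le_antisym)
qed

text \<open>The unit axiom presents \<open>p\<close> as the supremum of its meets with multiples of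
  \<open>\<one>\<close>, and all of these are at most zero when \<open>p\<close> is disjoint from
  the positive part of \<open>\<one>\<close>. This is the consistency of forcing.\<close>

lemma forces_one:
  assumes "forces p \<one>" "p \<in> C"
  shows "p = \<zero>"
proof -
  have p0: "\<zero> \<preceq> p"
    using assms inf_le1[of p "pos \<one>"] unfolding forces_def by simp
  have "\<ominus> p \<preceq> p" using neg_antimono[of \<zero> p] p0 assms le_trans[of "\<ominus> p" \<zero> p] by simp
  then have abs: "abs_srs G p = p"
    unfolding abs_srs_def using assms by (intro le_antisym sup_least) auto
  have "bigsup G p (\<lambda>n. p \<sqinter> real (Suc n) \<cdot> \<one>) = p"
    using unit[OF assms(2)] by (simp only: abs)
  \<comment> \<open>The additional meet with \<open>p\<close> is the truncation built into
    \<open>bigsup\<close>.\<close>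
  moreover have "lub (\<lambda>n. p \<sqinter> real (Suc n) \<cdot> \<one> \<sqinter> p) (bigsup G p (\<lambda>n. p \<sqinter> real (Suc n) \<cdot> \<one>))"
    using assms by (intro lub_bigsup) auto
  ultimately have "lub (\<lambda>n. p \<sqinter> real (Suc n) \<cdot> \<one> \<sqinter> p) p" by simp
  moreover have "p \<sqinter> real (Suc n) \<cdot> \<one> \<sqinter> p \<preceq> \<zero>" for n
  proof -
    have "p \<sqinter> real (Suc n) \<cdot> \<one> \<preceq> p \<sqinter> pos (real (Suc n) \<cdot> \<one>)"
      using assms le_trans[of "p \<sqinter> real (Suc n) \<cdot> \<one>" "real (Suc n) \<cdot> \<one>" "pos (real (Suc n) \<cdot> \<one>)"]
      by (intro inf_greatest) auto
    also have "\<dots> = \<zero>"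
      using forces_scale[OF assms, of "real (Suc n)"] unfolding forces_def by simp
    finally show ?thesis
      using assms le_trans[of "p \<sqinter> real (Suc n) \<cdot> \<one> \<sqinter> p" "p \<sqinter> real (Suc n) \<cdot> \<one>" \<zero>] by simp
  qed
  ultimately have "p \<preceq> \<zero>" unfolding lub_def by blast
  then show ?thesis using p0 assms by (intro le_antisym) auto
qed

text \<open>Positivity of the unit is derived: the positive part of \<open>\<ominus> \<one>\<close>
  forces \<open>\<one>\<close>, so it is zero.\<close>

lemma zero_le_one_G: "\<zero> \<preceq> \<one>"
proof -
  have "pos (\<ominus> \<one>) = \<zero>" using forces_pos_neg[of "\<ominus> \<one>"] by (intro forces_one) auto
  then have "\<ominus> \<one> \<preceq> \<zero>" using sup_ge1[of "\<ominus> \<one>" \<zero>] by simp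
  then show ?thesis using neg_antimono[of "\<ominus> \<one>" \<zero>] by simp
qed

text \<open>The stronger condition is the meet of \<open>p\<close> with \<open>pos u\<close>: it is
  nonzero because \<open>p\<close> does not force \<open>u\<close>, and it inherits
  \<open>\<ominus> u\<close> from \<open>pos u\<close>.\<close>

lemma forces_or_extends:
  assumes "p \<in> conds" "u \<in> C" "\<not> forces p u"
  obtains q where "q \<in> conds" "q \<preceq> p" "forces q (\<ominus> u)"
proof (rule that[of "p \<sqinter> pos u"])
  let ?q = "p \<sqinter> pos u"
  have p: "p \<in> C" "\<zero> \<preceq> p" using assms(1) unfolding conds_def by auto
  have q: "?q \<in> C" "\<zero> \<preceq> ?q" "?q \<preceq> pos u" using p assms(2) by (simp_all add: inf_greatest)
  then show "?q \<in> conds"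
    using assms(2,3) unfolding conds_def forces_def by simp
  show "?q \<preceq> p" using p assms(2) by simp
  show "forces ?q (\<ominus> u)"
    by (rule forces_mono[OF forces_pos_neg]) (use assms(2) q in simp_all)
qed

section \<open>Shifts by multiples of the unit\<close>

text \<open>Encodes comparison with a real: forcing \<open>shift a r\<close> means that
  \<open>a\<close> is at most \<open>r\<close> on the support, and forcing
  \<open>shift (\<ominus> a) (- r)\<close> that it is at least \<open>r\<close>.\<close>

definition shift :: "'a \<Rightarrow> real \<Rightarrow> 'a" where
  "shift a r = a \<oplus> (- r) \<cdot> \<one>"

lemma shift_closed [simp, intro]: "a \<in> C \<Longrightarrow> shift a r \<in> C"
  unfolding shift_def by simp

lemma shift_add:
  assumes "a \<in> C" "b \<in> C"
  shows "shift a r \<oplus> shift b s = shift (a \<oplus> b) (r + s)"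
proof -
  have "(- (r + s)) \<cdot> \<one> = (- r) \<cdot> \<one> \<oplus> (- s) \<cdot> \<one>"
    by (simp flip: add_scale)
  then show ?thesis
    unfolding shift_def using assms by (simp add: add_ac)
qed

lemma shift_scale: "a \<in> C \<Longrightarrow> c \<cdot> shift a r = shift (c \<cdot> a) (c * r)"
  unfolding shift_def by (simp add: scale_add scale_scale)

lemma shift_neg: "a \<in> C \<Longrightarrow> \<ominus> shift a r = shift (\<ominus> a) (- r)"
  unfolding shift_def by (simp add: neg_add minus_scale)

lemma shift_sup: "a \<in> C \<Longrightarrow> b \<in> C \<Longrightarrow> shift (a \<squnion> b) r = shift a r \<squnion> shift b r"
  unfolding shift_def by (simp add: sup_add)

lemma shift_mono:
  assumes "a \<preceq> b" "r \<le> s" "a \<in> C" "b \<in> C"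
  shows "shift a s \<preceq> shift b r"
  unfolding shift_def using assms scale_right_mono[OF zero_le_one_G, of "- s" "- r"]
  by (intro add_mono) auto

lemma lub_shift:
  assumes "lub f s"
  shows "lub (\<lambda>n. shift (f n) r) (shift s r)"
proof -
  have s: "s \<in> C" and f: "\<And>n. f n \<in> C" and up: "\<And>n. f n \<preceq> s"
    and least: "\<And>h. h \<in> C \<Longrightarrow> (\<And>n. f n \<preceq> h) \<Longrightarrow> s \<preceq> h" using assms unfolding lub_def by auto
  have "shift s r \<preceq> h" if "h \<in> C" "\<And>n. shift (f n) r \<preceq> h" for h
  proof -
    have "f n \<preceq> h \<oplus> r \<cdot> \<one>" for n
      using that(2)[of n] that(1) f[of n] unfolding shift_def
      by (simp add: minus_scale diff_le_iff)
    then have "s \<preceq> h \<oplus> r \<cdot> \<one>" using that(1) by (intro least) auto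
    then show ?thesis
      using that(1) s unfolding shift_def by (simp add: minus_scale diff_le_iff)
  qed
  then show ?thesis unfolding lub_def using s f up by (auto intro: shift_mono)
qed

text \<open>If \<open>p\<close> forced \<open>a\<close> to be at least n for every n, all multiples
  of the meet of \<open>p\<close> with \<open>\<one>\<close> would lie below \<open>pos a\<close>;
  that meet would be zero by the Archimedean property, against \<open>forces_one\<close>. So some n
  fails, and an extension forces the opposite inequality.\<close>

lemma forces_bounded:
  assumes p: "p \<in> conds" and a: "a \<in> C"
  obtains q n where "q \<in> conds" "q \<preceq> p" "forces q (shift a (real n))"
proof -
  have pC: "p \<in> C" "\<zero> \<preceq> p" "p \<noteq> \<zero>" using p unfolding conds_def by auto
  have "\<exists>n. \<not> forces p (shift (\<ominus> a) (- real n))"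
  proof (rule ccontr)
    assume "\<not> ?thesis"
    then have all: "forces p (shift (\<ominus> a) (- real n))" for n by blast
    \<comment> \<open>Being below \<open>p\<close>, this element inherits what \<open>p\<close>
      forces; being below \<open>\<one>\<close>, its n-fold multiple is at most n times the unit,
      which is split as (n - \<open>a\<close>) + \<open>a\<close>.\<close>
    let ?w = "p \<sqinter> \<one>"
    have w: "?w \<in> C" "\<zero> \<preceq> ?w" "?w \<preceq> p" "?w \<preceq> \<one>"
      using pC zero_le_one_G by (simp_all add: inf_greatest)
    have "real n \<cdot> ?w \<preceq> pos a" for n
    proof (rule le_of_disjoint)
      let ?v = "pos (shift (\<ominus> a) (- real n))"
      have "forces ?w (shift (\<ominus> a) (- real n))"
        by (rule forces_mono[OF all[of n]]) (use w pC a in simp_all)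
      then have "?v \<sqinter> ?w = \<zero>" using w(1) a inf_comm[of ?v ?w] by (simp add: forces_def)
      then have "?v \<sqinter> real n \<cdot> ?w = \<zero>" by (rule disjoint_scale) (use w a in simp_all)
      then show "real n \<cdot> ?w \<sqinter> ?v = \<zero>" using w(1) a inf_comm[of ?v "real n \<cdot> ?w"] by simp
      have "real n \<cdot> ?w \<preceq> real n \<cdot> \<one>" using w by (intro scale_mono) auto
      also have eq: "real n \<cdot> \<one> = shift (\<ominus> a) (- real n) \<oplus> a"
        using a add_comm[of "\<ominus> a" "real n \<cdot> \<one>"] unfolding shift_def by simp
      finally have "real n \<cdot> ?w \<preceq> shift (\<ominus> a) (- real n) \<oplus> a" .
      moreover have "shift (\<ominus> a) (- real n) \<oplus> a \<preceq> ?v \<oplus> pos a"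
        using a by (intro add_mono) auto
      ultimately show "real n \<cdot> ?w \<preceq> ?v \<oplus> pos a"
        by (rule le_trans) (use w(1) a in simp_all)
    qed (use w a in simp_all)
    then have "?w \<preceq> \<zero>" by (rule archimedean[rotated 2]) (use w a in simp_all)
    then have "?w = \<zero>" using w by (simp add: le_antisym)
    moreover have "pos \<one> = \<one>" using zero_le_one_G by (simp add: le_antisym sup_least)
    ultimately have "forces p \<one>" unfolding forces_def by simp
    then show False using forces_one pC by blast
  qed
  then obtain n where n: "\<not> forces p (shift (\<ominus> a) (- real n))" by blast
  have "shift (\<ominus> a) (- real n) \<in> C" using a by simp
  then obtain q where "q \<in> conds" "q \<preceq> p" "forces q (\<ominus> (shift (\<ominus> a) (- real n)))"
    by (rule forces_or_extends[OF p _ n])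
  then show ?thesis using a by (intro that[of q n]) (simp_all add: shift_neg)
qed

end

section \<open>The generic cone\<close>

text \<open>Axiomatises the set of all elements forced to be at most zero along a generic sequence;
  the last condition is consistency.\<close>

locale cone = sigma_riesz +
  fixes T :: "'a set"
  assumes T_closed: "u \<in> T \<Longrightarrow> u \<in> C"
    and T_zero: "\<zero> \<in> T"
    and T_add: "u \<in> T \<Longrightarrow> v \<in> T \<Longrightarrow> u \<oplus> v \<in> T"
    and T_sup: "u \<in> T \<Longrightarrow> v \<in> T \<Longrightarrow> u \<squnion> v \<in> T"
    and T_scale: "u \<in> T \<Longrightarrow> 0 \<le> c \<Longrightarrow> c \<cdot> u \<in> T"
    and T_down: "u \<in> T \<Longrightarrow> v \<preceq> u \<Longrightarrow> v \<in> C \<Longrightarrow> v \<in> T"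
    and one_notin_T: "\<one> \<notin> T"

text \<open>\<open>E\<close> lists the elements to receive upper bounds and \<open>L\<close> the
  suprema to be decided. Applied to a difference, the positive gap \<epsilon> for \<open>z\<close>
  later yields a strict inequality between real values.\<close>

lemma (in sigma_riesz) generic_cone:
  assumes E: "countable E" "E \<subseteq> C"
    and L: "countable L" "\<And>f s. (f, s) \<in> L \<Longrightarrow> lub f s"
    and z: "z \<in> C" "\<not> z \<preceq> \<zero>"
  obtains T \<epsilon> where "cone G T" "\<forall>a\<in>E. \<exists>n. shift a (real n) \<in> T"
    "\<forall>(f, s)\<in>L. s \<in> T \<or> (\<exists>n. \<ominus> f n \<in> T)"
    "\<epsilon> > 0" "\<ominus> shift z \<epsilon> \<in> T"
proof -
  \<comment> \<open>Otherwise \<open>z\<close> is below (1/n) times the unit for every n > 0, so all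
    its natural multiples are below \<open>\<one>\<close> and \<open>z\<close> is at most
    zero.\<close>
  have "\<exists>\<epsilon>>0. pos (shift z \<epsilon>) \<noteq> \<zero>"
  proof (rule ccontr)
    assume "\<not> ?thesis"
    then have pos: "pos (shift z \<epsilon>) = \<zero>" if "\<epsilon> > 0" for \<epsilon> using that by blast
    have "real n \<cdot> z \<preceq> \<one>" for n
    proof (cases "n = 0")
      case True
      then show ?thesis using z zero_le_one_G by simp
    next
      case False
      then have "shift z (1 / real n) \<preceq> \<zero>"
        using sup_ge1[of "shift z (1 / real n)" \<zero>] pos[of "1 / real n"] z by simp
      then have "z \<preceq> (1 / real n) \<cdot> \<one>" using z by (simp add: shift_def minus_scale diff_le_iff)
      then have "real n \<cdot> z \<preceq> real n \<cdot> (1 / real n) \<cdot> \<one>" using z by (simp add: scale_mono)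
      then show ?thesis using False by (simp add: scale_scale)
    qed
    then have "z \<preceq> \<zero>" by (rule archimedean[rotated 2]) (use z in simp_all)
    then show False using z by blast
  qed
  then obtain \<epsilon> where \<epsilon>: "\<epsilon> > 0" "pos (shift z \<epsilon>) \<noteq> \<zero>" by blast
  \<comment> \<open>The initial condition: on its support, \<open>z\<close> is at least
    \<epsilon>.\<close>
  let ?p0 = "pos (shift z \<epsilon>)"
  \<comment> \<open>Dense by \<open>forces_bounded\<close>.\<close>
  define D1 where "D1 a = {q. \<exists>n. forces q (shift a (real n))}" for a
  \<comment> \<open>Dense because a condition forcing every \<open>f n\<close> forces
    \<open>s\<close> by \<open>forces_lub\<close>, while one failing to force some
    \<open>f n\<close> extends to one forcing its negative.\<close>
  define D2 where "D2 = (\<lambda>(f :: nat \<Rightarrow> 'a, s). {q. forces q s \<or> (\<exists>n. forces q (\<ominus> f n))})"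
  let ?\<D> = "D1 ` E \<union> D2 ` L"
  have cond: "q \<in> C" "\<zero> \<preceq> q" if "q \<in> conds" for q
    using that unfolding conds_def by auto
  obtain p where p: "p 0 = ?p0" "\<And>n. p n \<in> conds" "\<And>n. p (Suc n) \<preceq> p n"
    "\<And>D. D \<in> ?\<D> \<Longrightarrow> \<exists>n. p n \<in> D"
  proof (rule generic_sequence[of ?\<D> ?p0 conds "\<lambda>x y. x \<preceq> y"])
    show "countable ?\<D>" using E L by simp
    show "?p0 \<in> conds" using \<epsilon> z unfolding conds_def by simp
    show "q \<preceq> q" if "q \<in> conds" for q using cond[OF that] by simp
    show "\<exists>q \<in> D \<inter> conds. q \<preceq> p" if D: "D \<in> ?\<D>" and p: "p \<in> conds" for D p
      using D
    proof
      assume "D \<in> D1 ` E"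
      then obtain a where a: "a \<in> E" "D = D1 a" by blast
      then have "a \<in> C" using E by blast
      then obtain q n where "q \<in> conds" "q \<preceq> p" "forces q (shift a (real n))"
        by (rule forces_bounded[OF p])
      then show ?thesis unfolding a D1_def by blast
    next
      assume "D \<in> D2 ` L"
      then obtain f s where fs: "(f, s) \<in> L" "D = D2 (f, s)" by auto
      have lub: "lub f s" using L(2) fs(1) by blast
      then have f: "f n \<in> C" for n unfolding lub_def by auto
      show ?thesis
      proof (cases "\<forall>n. forces p (f n)")
        case True
        then have "forces p s" using forces_lub[OF lub] cond(1)[OF p] by blast
        then show ?thesis using p cond(1)[OF p] unfolding fs D2_def by auto
      next
        case False
        then obtain n where "\<not> forces p (f n)" by blast
        then obtain q where "q \<in> conds" "q \<preceq> p" "forces q (\<ominus> f n)"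
          by (rule forces_or_extends[OF p f])
        then show ?thesis unfolding fs D2_def by auto
      qed
    qed
  qed blast
  have pC: "p n \<in> C" for n using cond(1)[OF p(2)] .
  have decreasing: "p n \<preceq> p m" if "m \<le> n" for m n
    using that
  proof (induction rule: dec_induct)
    case base
    show ?case using cond[OF p(2)] by simp
  next
    case (step n)
    from le_trans[OF p(3) step.IH] show ?case using cond[OF p(2)] by simp
  qed
  have later: "forces (p n) u" if "forces (p m) u" "m \<le> n" for m n u
    by (rule forces_mono[OF that(1)])
      (use that(1) decreasing[OF that(2)] cond[OF p(2)] in \<open>simp_all add: forces_def\<close>)
  have forces_z: "forces (p 0) (\<ominus> shift z \<epsilon>)"
    unfolding p(1) by (rule forces_pos_neg) (use z in simp)
  \<comment> \<open>The conditions decrease, so any two forced elements are forced by a common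
    condition; closure of T then reduces to closure of \<open>forces\<close> at a single
    condition.\<close>
  define T where "T = {u. \<exists>n. forces (p n) u}"
  have both: "\<exists>n. forces (p n) u \<and> forces (p n) v" if "u \<in> T" "v \<in> T" for u v
  proof -
    from that obtain m n where "forces (p m) u" "forces (p n) v" unfolding T_def by auto
    then have "forces (p (max m n)) u" "forces (p (max m n)) v" by (simp_all add: later)
    then show ?thesis by blast
  qed
  show ?thesis
  proof (rule that[of T \<epsilon>])
    show "cone G T"
    proof
      show "u \<in> C" if "u \<in> T" for u
        using that unfolding T_def forces_def by blast
      show "\<zero> \<in> T"
        using forces_scale[OF forces_z pC, of 0] z unfolding T_def by auto
      show "u \<oplus> v \<in> T" "u \<squnion> v \<in> T" if "u \<in> T" "v \<in> T" for u v
      proof -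
        from both[OF that] obtain n where "forces (p n) u" "forces (p n) v" by blast
        then show "u \<oplus> v \<in> T" "u \<squnion> v \<in> T"
          using forces_add[OF _ _ pC] forces_sup[OF _ _ pC] unfolding T_def by blast+
      qed
      show "c \<cdot> u \<in> T" if "u \<in> T" "0 \<le> c" for u c
        using that forces_scale[OF _ pC] unfolding T_def by auto
      show "v \<in> T" if "u \<in> T" "v \<preceq> u" "v \<in> C" for u v
        using that forces_mono[OF _ _ _ pC pC cond(2)[OF p(2)] le_refl[OF pC]] unfolding T_def by auto
      show "\<one> \<notin> T"
        using forces_one[OF _ pC] p(2) unfolding T_def conds_def by auto
    qed
    have "\<exists>n. shift a (real n) \<in> T" if "a \<in> E" for a
      using p(4)[of "D1 a"] that unfolding T_def D1_def by blast
    then show "\<forall>a\<in>E. \<exists>n. shift a (real n) \<in> T" by blast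
    have "s \<in> T \<or> (\<exists>n. \<ominus> f n \<in> T)" if "(f, s) \<in> L" for f s
      using p(4)[of "D2 (f, s)"] that unfolding T_def D2_def by blast
    then show "\<forall>(f, s)\<in>L. s \<in> T \<or> (\<exists>n. \<ominus> f n \<in> T)" by blast
    show "\<epsilon> > 0" by (rule \<epsilon>)
    show "\<ominus> shift z \<epsilon> \<in> T" using forces_z unfolding T_def by blast
  qed
qed

section \<open>Real values defined by a cone\<close>

context cone
begin

text \<open>For negative \<open>r\<close> the shift is a positive multiple of the unit, and
  rescaling would put \<open>\<one>\<close> into \<open>T\<close>.\<close>

lemma shift_zero_in_T:
  assumes "shift \<zero> r \<in> T"
  shows "0 \<le> r"
proof (rule ccontr)
  assume "\<not> 0 \<le> r"
  then have "(1 / - r) \<cdot> shift \<zero> r = \<one>" by (simp add: shift_def scale_scale)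
  then show False using T_scale[OF assms, of "1 / - r"] \<open>\<not> 0 \<le> r\<close> one_notin_T by simp
qed

lemma shift_T_mono:
  assumes "shift b r \<in> T" "a \<preceq> b" "r \<le> s" "a \<in> C" "b \<in> C"
  shows "shift a s \<in> T"
  by (rule T_down[OF assms(1)]) (use assms in \<open>simp_all add: shift_mono\<close>)

lemma shift_T_add:
  "shift a r \<in> T \<Longrightarrow> shift b s \<in> T \<Longrightarrow> a \<in> C \<Longrightarrow> b \<in> C \<Longrightarrow> shift (a \<oplus> b) (r + s) \<in> T"
  using T_add[of "shift a r" "shift b s"] by (simp add: shift_add)

text \<open>The two sides of a Dedekind cut, with slack \<epsilon> because \<open>T\<close> may fail
  to contain the comparison at the value itself.\<close>

definition has_value :: "'a \<Rightarrow> real \<Rightarrow> bool" where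
  "has_value a r \<longleftrightarrow> a \<in> C \<and>
     (\<forall>\<epsilon>>0. shift a (r + \<epsilon>) \<in> T \<and> shift (\<ominus> a) (- r + \<epsilon>) \<in> T)"

lemma has_value_closed: "has_value a r \<Longrightarrow> a \<in> C"
  unfolding has_value_def by simp

text \<open>Adding the upper bound for \<open>a\<close> to the nearly optimal one for
  \<open>\<ominus> a\<close> cancels \<open>a\<close> and leaves a shift of zero.\<close>

lemma has_value_le_bound:
  assumes "has_value a r" "shift a q \<in> T"
  shows "r \<le> q"
proof (rule field_le_epsilon)
  fix e :: real assume "e > 0"
  then have "shift (a \<oplus> \<ominus> a) (q + (- r + e)) \<in> T"
    using assms unfolding has_value_def by (intro shift_T_add) auto
  then show "r \<le> q + e"
    using shift_zero_in_T[of "q + (- r + e)"] has_value_closed[OF assms(1)] by simp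
qed

lemma has_value_mono:
  assumes "has_value a r" "has_value b s" "a \<preceq> b"
  shows "r \<le> s"
proof (rule field_le_epsilon)
  fix e :: real assume "e > 0"
  then have "shift b (s + e) \<in> T" using assms unfolding has_value_def by blast
  then have "shift a (s + e) \<in> T"
    by (rule shift_T_mono) (use assms has_value_closed in auto)
  then show "r \<le> s + e" using assms has_value_le_bound by blast
qed

lemma has_value_unique: "has_value a r \<Longrightarrow> has_value a s \<Longrightarrow> r = s"
  using has_value_mono[of a r a s] has_value_mono[of a s a r] has_value_closed[of a r] by simp

lemma has_value_neg: "has_value a r \<Longrightarrow> has_value (\<ominus> a) (- r)"
  unfolding has_value_def by simp

lemma has_value_neg_le_bound:
  "has_value a r \<Longrightarrow> shift (\<ominus> a) (- q) \<in> T \<Longrightarrow> q \<le> r"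
  using has_value_le_bound[OF has_value_neg, of a r "- q"] by simp

lemma has_value_zero: "has_value \<zero> 0"
proof -
  have "shift \<zero> \<epsilon> \<in> T" if "\<epsilon> > 0" for \<epsilon>
    using T_zero shift_T_mono[of \<zero> 0 \<zero> \<epsilon>] that by (simp add: shift_def)
  then show ?thesis unfolding has_value_def by simp
qed

lemma has_value_one: "has_value \<one> 1"
proof -
  have "shift \<one> 1 \<in> T" "shift (\<ominus> \<one>) (- 1) \<in> T"
    using T_zero by (simp_all add: shift_def minus_scale)
  then show ?thesis
    unfolding has_value_def using shift_T_mono[of \<one> 1 \<one>] shift_T_mono[of "\<ominus> \<one>" "- 1" "\<ominus> \<one>"] by simp
qed

lemma has_value_add:
  assumes "has_value a r" "has_value b s"
  shows "has_value (a \<oplus> b) (r + s)"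
proof -
  have ab: "a \<in> C" "b \<in> C" using assms has_value_closed by auto
  have "shift (a \<oplus> b) (r + s + \<epsilon>) \<in> T \<and> shift (\<ominus> (a \<oplus> b)) (- (r + s) + \<epsilon>) \<in> T" if "\<epsilon> > 0" for \<epsilon>
  proof -
    have half: "\<epsilon> / 2 > 0" using that by simp
    have "shift (a \<oplus> b) ((r + \<epsilon> / 2) + (s + \<epsilon> / 2)) \<in> T"
      "shift (\<ominus> a \<oplus> \<ominus> b) ((- r + \<epsilon> / 2) + (- s + \<epsilon> / 2)) \<in> T"
      using assms half ab unfolding has_value_def by (simp_all only: shift_T_add closed)
    moreover have "(r + \<epsilon> / 2) + (s + \<epsilon> / 2) = r + s + \<epsilon>"
      "(- r + \<epsilon> / 2) + (- s + \<epsilon> / 2) = - (r + s) + \<epsilon>" by simp_all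
    ultimately show ?thesis using ab by (simp only: neg_add)
  qed
  then show ?thesis unfolding has_value_def using ab by simp
qed

lemma has_value_scale_nonneg:
  assumes "has_value a r" "0 \<le> c"
  shows "has_value (c \<cdot> a) (c * r)"
proof (cases "c = 0")
  case True
  then show ?thesis using has_value_zero has_value_closed[OF assms(1)] by simp
next
  case False
  then have c: "c > 0" using assms by simp
  have a: "a \<in> C" using assms has_value_closed by auto
  have "shift (c \<cdot> a) (c * r + \<epsilon>) \<in> T \<and> shift (\<ominus> (c \<cdot> a)) (- (c * r) + \<epsilon>) \<in> T" if "\<epsilon> > 0" for \<epsilon>
  proof -
    have "\<epsilon> / c > 0" using that c by simp
    then have "c \<cdot> shift a (r + \<epsilon> / c) \<in> T" "c \<cdot> shift (\<ominus> a) (- r + \<epsilon> / c) \<in> T"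
      using assms unfolding has_value_def by (auto intro: T_scale)
    moreover have "c * (r + \<epsilon> / c) = c * r + \<epsilon>" "c * (- r + \<epsilon> / c) = - (c * r) + \<epsilon>"
      using c by (simp_all add: field_simps)
    ultimately show ?thesis using a by (simp add: shift_scale scale_neg)
  qed
  then show ?thesis unfolding has_value_def using a by simp
qed

lemma has_value_scale:
  assumes "has_value a r"
  shows "has_value (c \<cdot> a) (c * r)"
proof (cases "0 \<le> c")
  case True
  then show ?thesis using assms has_value_scale_nonneg by simp
next
  case False
  then have "has_value (\<ominus> ((- c) \<cdot> a)) (- ((- c) * r))"
    using assms by (intro has_value_neg has_value_scale_nonneg) auto
  then show ?thesis using has_value_closed[OF assms] by (simp add: minus_scale)
qed

lemma has_value_sup:
  assumes "has_value a r" "has_value b s"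
  shows "has_value (a \<squnion> b) (max r s)"
proof -
  have ab: "a \<in> C" "b \<in> C" using assms has_value_closed by auto
  have "shift (a \<squnion> b) (max r s + \<epsilon>) \<in> T" if "\<epsilon> > 0" for \<epsilon>
  proof -
    have "shift a (r + \<epsilon>) \<in> T" "shift b (s + \<epsilon>) \<in> T"
      using assms that unfolding has_value_def by auto
    then have "shift a (max r s + \<epsilon>) \<in> T" "shift b (max r s + \<epsilon>) \<in> T"
      using shift_T_mono[of a "r + \<epsilon>" a "max r s + \<epsilon>"] shift_T_mono[of b "s + \<epsilon>" b "max r s + \<epsilon>"] ab
      by simp_all
    then show ?thesis using T_sup ab by (simp add: shift_sup)
  qed
  moreover have "shift (\<ominus> (a \<squnion> b)) (- max r s + \<epsilon>) \<in> T" if "\<epsilon> > 0" for \<epsilon>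
  proof -
    have "shift (\<ominus> a) (- r + \<epsilon>) \<in> T" "shift (\<ominus> b) (- s + \<epsilon>) \<in> T"
      using assms that unfolding has_value_def by auto
    moreover have "\<ominus> (a \<squnion> b) \<preceq> \<ominus> a" "\<ominus> (a \<squnion> b) \<preceq> \<ominus> b"
      using ab by (simp_all add: neg_antimono)
    ultimately have "shift (\<ominus> (a \<squnion> b)) (- r + \<epsilon>) \<in> T" "shift (\<ominus> (a \<squnion> b)) (- s + \<epsilon>) \<in> T"
      using ab shift_T_mono[of "\<ominus> a" "- r + \<epsilon>" "\<ominus> (a \<squnion> b)" "- r + \<epsilon>"]
        shift_T_mono[of "\<ominus> b" "- s + \<epsilon>" "\<ominus> (a \<squnion> b)" "- s + \<epsilon>"] by simp_all
    \<comment> \<open>The maximum is one of the two values, and the lower bound is available for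
      both.\<close>
    then show ?thesis by (simp add: max_def)
  qed
  ultimately show ?thesis unfolding has_value_def using ab by simp
qed

lemma has_value_inf:
  assumes "has_value a r" "has_value b s"
  shows "has_value (a \<sqinter> b) (min r s)"
proof -
  have ab: "a \<in> C" "b \<in> C" using assms has_value_closed by auto
  have "has_value (\<ominus> (\<ominus> a \<squnion> \<ominus> b)) (- max (- r) (- s))"
    using assms by (intro has_value_neg has_value_sup)
  moreover have "\<ominus> (\<ominus> a \<squnion> \<ominus> b) = a \<sqinter> b"
    using ab by (simp flip: neg_inf)
  moreover have "- max (- r) (- s) = min r s" by (simp add: max_def min_def)
  ultimately show ?thesis by simp
qed

text \<open>The value is the infimum of the upper bounds recorded in \<open>T\<close>; the two
  assumed bounds make this set nonempty and bounded below. Deciding rational levels suffices, since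
  the rationals are dense.\<close>

lemma has_value_exists:
  assumes a: "a \<in> C" and bounds: "shift a u \<in> T" "shift (\<ominus> a) l \<in> T"
    and cut: "\<And>q. q \<in> \<rat> \<Longrightarrow> shift a q \<in> T \<or> shift (\<ominus> a) (- q) \<in> T"
  obtains r where "has_value a r"
proof -
  let ?Q = "{q. shift a q \<in> T}"
  have "- l \<le> q" if "shift a q \<in> T" for q
    using shift_zero_in_T[of "q + l"] shift_T_add[OF that bounds(2)] a by simp
  then have below: "bdd_below ?Q" by (intro bdd_belowI[of _ "- l"]) simp
  have "shift a (Inf ?Q + \<epsilon>) \<in> T \<and> shift (\<ominus> a) (- Inf ?Q + \<epsilon>) \<in> T" if "\<epsilon> > 0" for \<epsilon>
  proof
    have "?Q \<noteq> {}" using bounds(1) by blast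
    from cInf_lessD[OF this, of "Inf ?Q + \<epsilon>"] that
    obtain q where "q \<in> ?Q" "q < Inf ?Q + \<epsilon>" by auto
    then show "shift a (Inf ?Q + \<epsilon>) \<in> T" using a shift_T_mono[of a q a] by simp
    \<comment> \<open>A rational just below the infimum is no recorded upper bound, so its cut was
      decided as a lower bound.\<close>
    obtain q' where q': "q' \<in> \<rat>" "Inf ?Q - \<epsilon> < q'" "q' < Inf ?Q"
      using Rats_dense_in_real[of "Inf ?Q - \<epsilon>" "Inf ?Q"] \<open>\<epsilon> > 0\<close> by auto
    then have "shift a q' \<notin> T" using cInf_lower[OF _ below, of q'] by auto
    then have "shift (\<ominus> a) (- q') \<in> T" using cut q' by blast
    then show "shift (\<ominus> a) (- Inf ?Q + \<epsilon>) \<in> T"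
      using a q' shift_T_mono[of "\<ominus> a" "- q'" "\<ominus> a"] by simp
  qed
  then have "has_value a (Inf ?Q)" unfolding has_value_def using a by simp
  then show ?thesis by (rule that)
qed

text \<open>Monotonicity gives one inequality. A gap in the other would contain a rational q: then
  either q bounds \<open>s\<close> from above, against q < \<sigma>, or some member has value at
  least q, against the choice of q above the supremum.\<close>

lemma has_value_lub:
  assumes lub: "lub f s" and f: "\<And>n. has_value (f n) (\<rho> n)" and s: "has_value s \<sigma>"
    and cut: "\<And>q. q \<in> \<rat> \<Longrightarrow> shift s q \<in> T \<or> (\<exists>n. shift (\<ominus> f n) (- q) \<in> T)"
  shows "\<sigma> = (SUP n. \<rho> n)"
proof (rule antisym)
  have le: "\<rho> n \<le> \<sigma>" for n
    using has_value_mono[OF f s] lub unfolding lub_def by blast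
  then show "(SUP n. \<rho> n) \<le> \<sigma>" by (intro cSUP_least) auto
  have bdd: "bdd_above (range \<rho>)" using le by (intro bdd_aboveI[of _ \<sigma>]) auto
  show "\<sigma> \<le> (SUP n. \<rho> n)"
  proof (rule ccontr)
    assume "\<not> \<sigma> \<le> (SUP n. \<rho> n)"
    then obtain q where q: "q \<in> \<rat>" "(SUP n. \<rho> n) < q" "q < \<sigma>"
      using Rats_dense_in_real[of "SUP n. \<rho> n" \<sigma>] by auto
    from cut[OF q(1)] show False
    proof
      assume "shift s q \<in> T"
      then show False using has_value_le_bound[OF s, of q] q by simp
    next
      assume "\<exists>n. shift (\<ominus> f n) (- q) \<in> T"
      then obtain n where "q \<le> \<rho> n" using has_value_neg_le_bound[OF f] by blast
      then show False using cSUP_upper[OF UNIV_I bdd, of n] q by simp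
    qed
  qed
qed

end

section \<open>Separating valuations\<close>

text \<open>A valuation is any real function on the whole type, and only the instances with
  arguments from \<open>A\<close> and \<open>S\<close> are imposed, so that countably many can be
  met at a time. If \<open>zero G\<close> equals \<open>one G\<close>, no function is
  compatible.\<close>

definition compatible :: "'a srs \<Rightarrow> 'a set \<Rightarrow> ('a \<times> (nat \<Rightarrow> 'a)) set \<Rightarrow> ('a \<Rightarrow> real) \<Rightarrow> bool" where
  "compatible G A S \<phi> \<longleftrightarrow> \<phi> (zero G) = 0 \<and> \<phi> (one G) = 1 \<and>
     (\<forall>a\<in>A. \<forall>b\<in>A. \<phi> (add G a b) = \<phi> a + \<phi> b \<and> \<phi> (sup_op G a b) = max (\<phi> a) (\<phi> b) \<and>
        \<phi> (inf_op G a b) = min (\<phi> a) (\<phi> b)) \<and>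
     (\<forall>a\<in>A. \<phi> (neg G a) = - \<phi> a \<and> (\<forall>c. \<phi> (smul G c a) = c * \<phi> a)) \<and>
     (\<forall>(g, f)\<in>S. \<phi> (bigsup G g f) = (SUP n. min (\<phi> (f n)) (\<phi> g)))"

lemma compatible_mono: "compatible G A S \<phi> \<Longrightarrow> A' \<subseteq> A \<Longrightarrow> S' \<subseteq> S \<Longrightarrow> compatible G A' S' \<phi>"
  unfolding compatible_def by blast

definition bigsup_args :: "'a srs \<Rightarrow> ('a \<times> (nat \<Rightarrow> 'a)) set" where
  "bigsup_args G = {(g, f). g \<in> carrier G \<and> range f \<subseteq> carrier G}"

lemma (in sigma_riesz) exists_separating:
  assumes A: "countable A" "A \<subseteq> C" and S: "countable S" "S \<subseteq> bigsup_args G"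
    and x: "x \<in> C" and y: "y \<in> C" and xy: "\<not> x \<preceq> y"
  obtains \<phi> where "compatible G A S \<phi>" "\<phi> y < \<phi> x"
proof -
  \<comment> \<open>All elements to be given a value by a decided cut: the arguments in
    \<open>A\<close>, the two points to separate, and the arguments and results of the suprema in
    \<open>S\<close>.\<close>
  define B where "B = A \<union> {x, y} \<union> (\<Union>(g, f)\<in>S. {g, bigsup G g f} \<union> range f)"
  have args: "g \<in> C" "f n \<in> C" if "(g, f) \<in> S" for g f n
    using that S(2) unfolding bigsup_args_def by auto
  have cB: "countable B" unfolding B_def using A S by (auto intro!: countable_UN)
  have BC: "b \<in> C" if "b \<in> B" for b
    using that A x y args unfolding B_def by auto
  have SB: "g \<in> B" "f n \<in> B" "bigsup G g f \<in> B" if "(g, f) \<in> S" for g f n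
    using that unfolding B_def by auto
  \<comment> \<open>Upper bounds for negatives serve as lower bounds.\<close>
  define E where "E = B \<union> (\<lambda>b. \<ominus> b) ` B"
  \<comment> \<open>Constant sequences turn the decision of a supremum into the decision of a
    rational cut of one element; the second family decides each supremum of \<open>S\<close> at
    every rational level.\<close>
  define L where "L = (\<lambda>(a, q). (\<lambda>_::nat. shift a q, shift a q)) ` (B \<times> \<rat>) \<union>
     (\<lambda>((g, f), q). (\<lambda>n. shift (f n \<sqinter> g) q, shift (bigsup G g f) q)) ` (S \<times> \<rat>)"
  have "countable E" unfolding E_def using cB by simp
  moreover have "E \<subseteq> C" unfolding E_def using BC by auto
  moreover have "countable L"
    unfolding L_def using cB S(1) countable_rat by (intro countable_Un countable_image countable_SIGMA)
  moreover have "lub f s" if fs: "(f, s) \<in> L" for f s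
  proof -
    from fs consider a q where "a \<in> B" "f = (\<lambda>_. shift a q)" "s = shift a q"
      | g f' q where "(g, f') \<in> S" "f = (\<lambda>n. shift (f' n \<sqinter> g) q)" "s = shift (bigsup G g f') q"
      unfolding L_def by auto
    then show ?thesis
    proof cases
      case 1
      then show ?thesis using BC unfolding lub_def by auto
    next
      case 2
      then show ?thesis using lub_shift[OF lub_bigsup[OF args]] by simp
    qed
  qed
  moreover have "x \<oplus> \<ominus> y \<in> C" "\<not> x \<oplus> \<ominus> y \<preceq> \<zero>"
    using x y xy by (simp_all add: diff_le_iff)
  ultimately obtain T \<epsilon> where T: "cone G T" "\<forall>a\<in>E. \<exists>n. shift a (real n) \<in> T"
    "\<forall>(f, s)\<in>L. s \<in> T \<or> (\<exists>n. \<ominus> f n \<in> T)"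
    and \<epsilon>: "\<epsilon> > 0" "\<ominus> shift (x \<oplus> \<ominus> y) \<epsilon> \<in> T"
    by (rule generic_cone)
  interpret cone G T by (rule T(1))
  \<comment> \<open>Where no value exists, the description operator gives an unspecified
    number.\<close>
  define \<phi> where "\<phi> a = (THE r. has_value a r)" for a
  have \<phi>: "\<phi> a = r" if "has_value a r" for a r
    unfolding \<phi>_def using that has_value_unique by blast
  have val: "has_value b (\<phi> b)" if b: "b \<in> B" for b
  proof -
    have bC: "b \<in> C" using BC b by simp
    obtain n m where "shift b (real n) \<in> T" "shift (\<ominus> b) (real m) \<in> T"
      using T(2) b unfolding E_def by blast
    moreover have "shift b q \<in> T \<or> shift (\<ominus> b) (- q) \<in> T" if "q \<in> \<rat>" for q
    proof -
      have "(\<lambda>_. shift b q, shift b q) \<in> L" unfolding L_def using b that by force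
      from bspec[OF T(3) this] show ?thesis using bC by (simp add: shift_neg)
    qed
    ultimately obtain r where "has_value b r" by (rule has_value_exists[OF bC])
    then show ?thesis using \<phi> by simp
  qed
  have A_value: "has_value a (\<phi> a)" if "a \<in> A" for a
    using val that unfolding B_def by blast
  show ?thesis
  proof (rule that[of \<phi>])
    have "\<phi> (bigsup G g f) = (SUP n. min (\<phi> (f n)) (\<phi> g))" if gf: "(g, f) \<in> S" for g f
    proof (rule has_value_lub[OF lub_bigsup])
      show "g \<in> C" "f n \<in> C" for n using args[OF gf] by auto
      show "has_value (f n \<sqinter> g) (min (\<phi> (f n)) (\<phi> g))" for n
        by (intro has_value_inf val SB[OF gf])
      show "has_value (bigsup G g f) (\<phi> (bigsup G g f))"
        by (intro val SB[OF gf])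
      show "shift (bigsup G g f) q \<in> T \<or> (\<exists>n. shift (\<ominus> (f n \<sqinter> g)) (- q) \<in> T)" if "q \<in> \<rat>" for q
      proof -
        have "(\<lambda>n. shift (f n \<sqinter> g) q, shift (bigsup G g f) q) \<in> L"
          unfolding L_def using gf that by force
        from bspec[OF T(3) this] show ?thesis using args[OF gf] by (simp add: shift_neg)
      qed
    qed
    \<comment> \<open>Sums, meets and other results of finitary operations on \<open>A\<close> need
      not lie in \<open>B\<close>; their values come from the arithmetic of
      \<open>has_value\<close>.\<close>
    then show "compatible G A S \<phi>"
      unfolding compatible_def
      using \<phi>[OF has_value_zero] \<phi>[OF has_value_one]
        \<phi>[OF has_value_add[OF A_value A_value]] \<phi>[OF has_value_sup[OF A_value A_value]]
        \<phi>[OF has_value_inf[OF A_value A_value]]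
        \<phi>[OF has_value_neg[OF A_value]] \<phi>[OF has_value_scale[OF A_value]]
      by auto
    have xyB: "has_value x (\<phi> x)" "has_value y (\<phi> y)"
      using val unfolding B_def by auto
    have "\<epsilon> \<le> \<phi> x + - \<phi> y"
    proof (rule has_value_neg_le_bound)
      show "has_value (x \<oplus> \<ominus> y) (\<phi> x + - \<phi> y)"
        by (intro has_value_add has_value_neg xyB)
      show "shift (\<ominus> (x \<oplus> \<ominus> y)) (- \<epsilon>) \<in> T"
        using \<epsilon>(2) x y by (simp add: shift_neg)
    qed
    then show "\<phi> y < \<phi> x" using \<epsilon>(1) by simp
  qed
qed

text \<open>Two functions are identified if they agree at every valuation respecting a suitable countable
  set of operation instances, i.e. off a countable union of sets on which one instance fails.\<close>

definition ae_eq :: "'a srs \<Rightarrow> ((('a \<Rightarrow> real) \<Rightarrow> real) \<times> (('a \<Rightarrow> real) \<Rightarrow> real)) set" where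
  "ae_eq G = {(u, v). \<exists>A S. countable A \<and> A \<subseteq> carrier G \<and> countable S \<and> S \<subseteq> bigsup_args G \<and>
     (\<forall>\<phi>. compatible G A S \<phi> \<longrightarrow> u \<phi> = v \<phi>)}"

section \<open>Agreement off countably many failure sets is a congruence\<close>

lemma ae_eqI:
  assumes "countable A" "A \<subseteq> carrier G" "countable S" "S \<subseteq> bigsup_args G"
    "\<And>\<phi>. compatible G A S \<phi> \<Longrightarrow> u \<phi> = v \<phi>"
  shows "(u, v) \<in> ae_eq G"
  using assms unfolding ae_eq_def by blast

text \<open>A valuation compatible with the unions of the witnessing sets is compatible with each of
  them, and these unions are still countable. This makes the relation respect countable
  suprema.\<close>

lemma ae_eq_countable:
  assumes "\<And>n::nat. (u n, v n) \<in> ae_eq G" "\<And>\<phi>. (\<And>n. u n \<phi> = v n \<phi>) \<Longrightarrow> u' \<phi> = v' \<phi>"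
  shows "(u', v') \<in> ae_eq G"
proof -
  have "\<forall>n. \<exists>A S. countable A \<and> A \<subseteq> carrier G \<and> countable S \<and> S \<subseteq> bigsup_args G \<and>
     (\<forall>\<phi>. compatible G A S \<phi> \<longrightarrow> u n \<phi> = v n \<phi>)"
    using assms(1) unfolding ae_eq_def by simp
  then obtain A S where AS: "\<And>n. countable (A n)" "\<And>n. A n \<subseteq> carrier G" "\<And>n. countable (S n)"
      "\<And>n. S n \<subseteq> bigsup_args G" "\<And>n \<phi>. compatible G (A n) (S n) \<phi> \<Longrightarrow> u n \<phi> = v n \<phi>"
    by metis
  show ?thesis
  proof (rule ae_eqI[of "\<Union>n. A n" _ "\<Union>n. S n"])
    show "u' \<phi> = v' \<phi>" if "compatible G (\<Union>n. A n) (\<Union>n. S n) \<phi>" for \<phi>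
      by (rule assms(2), rule AS(5), rule compatible_mono[OF that]) auto
    show "countable (\<Union>n. A n)" "countable (\<Union>n. S n)" using AS(1,3) by simp_all
    show "(\<Union>n. A n) \<subseteq> carrier G" "(\<Union>n. S n) \<subseteq> bigsup_args G"
      using AS(2,4) by (simp_all add: UN_subset_iff)
  qed
qed

lemma ae_eq_binary:
  assumes "(u, v) \<in> ae_eq G" "(u', v') \<in> ae_eq G"
    "\<And>\<phi>. u \<phi> = v \<phi> \<Longrightarrow> u' \<phi> = v' \<phi> \<Longrightarrow> u'' \<phi> = v'' \<phi>"
  shows "(u'', v'') \<in> ae_eq G"
proof (rule ae_eq_countable)
  \<comment> \<open>The two pairs are arranged as a sequence that is constant from index 1
    on.\<close>
  show "(case n of 0 \<Rightarrow> u | Suc _ \<Rightarrow> u', case n of 0 \<Rightarrow> v | Suc _ \<Rightarrow> v') \<in> ae_eq G" for n :: nat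
    using assms(1,2) by (simp split: nat.split)
  fix \<phi>
  assume "\<And>n::nat. (case n of 0 \<Rightarrow> u | Suc _ \<Rightarrow> u') \<phi> = (case n of 0 \<Rightarrow> v | Suc _ \<Rightarrow> v') \<phi>"
  from this[of 0] this[of 1] show "u'' \<phi> = v'' \<phi>" by (intro assms(3)) simp_all
qed

lemma ae_eq_pointwise:
  assumes "(u, v) \<in> ae_eq G" "\<And>\<phi>. u \<phi> = v \<phi> \<Longrightarrow> u' \<phi> = v' \<phi>"
  shows "(u', v') \<in> ae_eq G"
  by (rule ae_eq_binary[OF assms(1,1)]) (rule assms(2))

lemma ae_eq_refl: "(u, u) \<in> ae_eq G"
  by (rule ae_eqI[of "{}" _ "{}"]) auto

lemma equiv_ae_eq: "equiv UNIV (ae_eq G)"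
proof (rule equivI)
  show "refl (ae_eq G)" by (rule refl_onI) (auto intro: ae_eq_refl)
  show "sym (ae_eq G)" by (rule symI, erule ae_eq_pointwise) simp
  show "trans (ae_eq G)" by (rule transI, erule (1) ae_eq_binary) simp
qed auto

lemma congruence_ae_eq: "congruence_srs power_srs (ae_eq G)"
  unfolding congruence_srs_def power_srs_def real_srs_def
proof (simp add: equiv_ae_eq, intro conjI allI impI)
  fix x x' y y' assume *: "(x, x') \<in> ae_eq G" "(y, y') \<in> ae_eq G"
  show "(\<lambda>i. x i + y i, \<lambda>i. x' i + y' i) \<in> ae_eq G"
    "(\<lambda>i. max (x i) (y i), \<lambda>i. max (x' i) (y' i)) \<in> ae_eq G"
    "(\<lambda>i. min (x i) (y i), \<lambda>i. min (x' i) (y' i)) \<in> ae_eq G"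
    by (rule ae_eq_binary[OF *], simp)+
next
  fix x x' and c :: real assume *: "(x, x') \<in> ae_eq G"
  show "(\<lambda>i. - x i, \<lambda>i. - x' i) \<in> ae_eq G" "(\<lambda>i. c * x i, \<lambda>i. c * x' i) \<in> ae_eq G"
    by (rule ae_eq_pointwise[OF *], simp)+
next
  fix g g' and f f' :: "nat \<Rightarrow> ('a \<Rightarrow> real) \<Rightarrow> real"
  assume *: "(g, g') \<in> ae_eq G" "\<forall>n. (f n, f' n) \<in> ae_eq G"
  show "(\<lambda>i. SUP n. min (f n i) (g i), \<lambda>i. SUP n. min (f' n i) (g' i)) \<in> ae_eq G"
  \<comment> \<open>The supremum at an index depends only on the sequence of truncated values
    there.\<close>
  proof (rule ae_eq_countable[where u = "\<lambda>n i. min (f n i) (g i)" and v = "\<lambda>n i. min (f' n i) (g' i)"])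
    show "(\<lambda>i. min (f n i) (g i), \<lambda>i. min (f' n i) (g' i)) \<in> ae_eq G" for n
      by (rule ae_eq_binary[OF *(1) *(2)[rule_format, of n]]) simp
  qed simp
qed

section \<open>The embedding into a quotient of a power of the reals\<close>

theorem mainTheorem15:
  fixes G :: "'a srs"
  assumes "in_V G"
  shows "\<exists>(\<theta> :: ((('a \<Rightarrow> real) \<Rightarrow> real) \<times> (('a \<Rightarrow> real) \<Rightarrow> real)) set) S h.
           congruence_srs power_srs \<theta> \<and>
           subalgebra_srs S (quotient_srs power_srs \<theta>) \<and>
           iso_srs G S h"
proof -
  interpret sigma_riesz G by unfold_locales (rule assms)
  let ?\<theta> = "ae_eq G"
  let ?Q = "quotient_srs power_srs ?\<theta>"
  have cong: "congruence_srs power_srs ?\<theta>" by (rule congruence_ae_eq)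
  \<comment> \<open>The power is indexed by all functions from the type to the reals, compatible or
    not; the quotient takes care of those violating the relevant instances.\<close>
  define ev :: "'a \<Rightarrow> ('a \<Rightarrow> real) \<Rightarrow> real" where "ev = (\<lambda>x \<phi>. \<phi> x)"
  define h where "h x = ?\<theta> `` {ev x}" for x
  have class_eq: "?\<theta> `` {u} = ?\<theta> `` {v}" if "(u, v) \<in> ?\<theta>" for u v
    by (rule equiv_class_eq[OF equiv_ae_eq that])
  \<comment> \<open>Quotient operations act on chosen representatives, which may differ from
    evaluations but are always identified with them.\<close>
  have rep: "(rep (h x), ev x) \<in> ?\<theta>" for x
  proof -
    have "ev x \<in> h x" unfolding h_def using ae_eq_refl by blast
    then have "rep (h x) \<in> h x" unfolding rep_def by (rule someI[where P = "\<lambda>u. u \<in> h x"])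
    then show ?thesis unfolding h_def using equiv_ae_eq[of G] by (auto elim: equivE dest: symD)
  qed
  have hom: "h (add G x y) = add ?Q (h x) (h y)" "h (sup_op G x y) = sup_op ?Q (h x) (h y)"
    "h (inf_op G x y) = inf_op ?Q (h x) (h y)" if "x \<in> C" "y \<in> C" for x y
  proof -
    \<comment> \<open>A homomorphism identity holds at every valuation respecting that single
      instance, which already gives equality of classes.\<close>
    have r: "compatible G {x, y} {} \<phi> \<Longrightarrow> \<phi> (add G x y) = \<phi> x + \<phi> y \<and>
       \<phi> (sup_op G x y) = max (\<phi> x) (\<phi> y) \<and> \<phi> (inf_op G x y) = min (\<phi> x) (\<phi> y)" for \<phi>
      unfolding compatible_def by blast
    have "(ev (add G x y), \<lambda>\<phi>. ev x \<phi> + ev y \<phi>) \<in> ?\<theta>"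
      "(ev (sup_op G x y), \<lambda>\<phi>. max (ev x \<phi>) (ev y \<phi>)) \<in> ?\<theta>"
      "(ev (inf_op G x y), \<lambda>\<phi>. min (ev x \<phi>) (ev y \<phi>)) \<in> ?\<theta>"
      by (rule ae_eqI[of "{x, y}" _ "{}"]; use that r in \<open>simp add: ev_def\<close>)+
    moreover have "(\<lambda>\<phi>. rep (h x) \<phi> + rep (h y) \<phi>, \<lambda>\<phi>. ev x \<phi> + ev y \<phi>) \<in> ?\<theta>"
      "(\<lambda>\<phi>. max (rep (h x) \<phi>) (rep (h y) \<phi>), \<lambda>\<phi>. max (ev x \<phi>) (ev y \<phi>)) \<in> ?\<theta>"
      "(\<lambda>\<phi>. min (rep (h x) \<phi>) (rep (h y) \<phi>), \<lambda>\<phi>. min (ev x \<phi>) (ev y \<phi>)) \<in> ?\<theta>"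
      by (rule ae_eq_binary[OF rep[of x] rep[of y]]; simp)+
    ultimately show "h (add G x y) = add ?Q (h x) (h y)"
      "h (sup_op G x y) = sup_op ?Q (h x) (h y)" "h (inf_op G x y) = inf_op ?Q (h x) (h y)"
      unfolding h_def[of "add G x y"] h_def[of "sup_op G x y"] h_def[of "inf_op G x y"]
      by (simp_all add: quotient_srs_def power_srs_def class_eq)
  qed
  have hom1: "h (neg G x) = neg ?Q (h x)" "h (smul G c x) = smul ?Q c (h x)" if "x \<in> C" for x c
  proof -
    have r: "compatible G {x} {} \<phi> \<Longrightarrow> \<phi> (neg G x) = - \<phi> x \<and> \<phi> (smul G c x) = c * \<phi> x" for \<phi>
      unfolding compatible_def by blast
    have "(ev (neg G x), \<lambda>\<phi>. - ev x \<phi>) \<in> ?\<theta>" "(ev (smul G c x), \<lambda>\<phi>. c * ev x \<phi>) \<in> ?\<theta>"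
      by (rule ae_eqI[of "{x}" _ "{}"]; use that r in \<open>simp add: ev_def\<close>)+
    moreover have "(\<lambda>\<phi>. - rep (h x) \<phi>, \<lambda>\<phi>. - ev x \<phi>) \<in> ?\<theta>"
      "(\<lambda>\<phi>. c * rep (h x) \<phi>, \<lambda>\<phi>. c * ev x \<phi>) \<in> ?\<theta>"
      by (rule ae_eq_pointwise[OF rep[of x]]; simp)+
    ultimately show "h (neg G x) = neg ?Q (h x)" "h (smul G c x) = smul ?Q c (h x)"
      unfolding h_def[of "neg G x"] h_def[of "smul G c x"]
      by (simp_all add: quotient_srs_def power_srs_def class_eq)
  qed
  have hom0: "h (zero G) = zero ?Q" "h (one G) = one ?Q"
  proof -
    have "(ev (zero G), \<lambda>\<phi>. 0) \<in> ?\<theta>" "(ev (one G), \<lambda>\<phi>. 1) \<in> ?\<theta>"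
      by (rule ae_eqI[of "{}" _ "{}"]; simp add: ev_def compatible_def)+
    then show "h (zero G) = zero ?Q" "h (one G) = one ?Q"
      by (simp_all add: h_def quotient_srs_def power_srs_def class_eq)
  qed
  have hom_bigsup: "h (bigsup G g f) = bigsup ?Q (h g) (\<lambda>n. h (f n))"
    if "g \<in> C" "range f \<subseteq> C" for g f
  proof -
    have r: "compatible G {} {(g, f)} \<phi> \<Longrightarrow> \<phi> (bigsup G g f) = (SUP n. min (\<phi> (f n)) (\<phi> g))" for \<phi>
      unfolding compatible_def by blast
    have "(ev (bigsup G g f), \<lambda>\<phi>. SUP n. min (ev (f n) \<phi>) (ev g \<phi>)) \<in> ?\<theta>"
      by (rule ae_eqI[of "{}" _ "{(g, f)}"]) (use that r in \<open>simp_all add: ev_def bigsup_args_def\<close>)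
    moreover have "(\<lambda>\<phi>. SUP n. min (rep (h (f n)) \<phi>) (rep (h g) \<phi>),
        \<lambda>\<phi>. SUP n. min (ev (f n) \<phi>) (ev g \<phi>)) \<in> ?\<theta>"
    proof (rule ae_eq_countable[where u = "\<lambda>n \<phi>. min (rep (h (f n)) \<phi>) (rep (h g) \<phi>)"
          and v = "\<lambda>n \<phi>. min (ev (f n) \<phi>) (ev g \<phi>)"])
      show "(\<lambda>\<phi>. min (rep (h (f n)) \<phi>) (rep (h g) \<phi>), \<lambda>\<phi>. min (ev (f n) \<phi>) (ev g \<phi>)) \<in> ?\<theta>" for n
        by (rule ae_eq_binary[OF rep[of "f n"] rep[of g]]) simp
    qed simp
    ultimately show ?thesis
      unfolding h_def[of "bigsup G g f"]
      by (simp add: quotient_srs_def power_srs_def real_srs_def class_eq)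
  qed
  have "inj_on h C"
  proof (rule inj_onI, rule ccontr)
    fix x y assume xy: "x \<in> C" "y \<in> C" "h x = h y" "x \<noteq> y"
    have "(ev x, ev y) \<in> ?\<theta>"
      using xy(3) eq_equiv_class[OF _ equiv_ae_eq] unfolding h_def by blast
    then obtain A S where AS: "countable A" "A \<subseteq> C" "countable S" "S \<subseteq> bigsup_args G"
      and eq: "\<And>\<phi>. compatible G A S \<phi> \<Longrightarrow> \<phi> x = \<phi> y"
      unfolding ae_eq_def ev_def by auto
    \<comment> \<open>Were this to fail, separation over the very sets \<open>A\<close> and
      \<open>S\<close> that witness the identification would give a compatible valuation telling the
      two elements apart.\<close>
    have le: "a \<preceq> b" if ab: "a \<in> C" "b \<in> C" "\<And>\<phi>. compatible G A S \<phi> \<Longrightarrow> \<phi> a = \<phi> b" for a b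
    proof (rule ccontr)
      assume "\<not> a \<preceq> b"
      then obtain \<phi> where "compatible G A S \<phi>" "\<phi> b < \<phi> a"
        by (rule exists_separating[OF AS ab(1,2)])
      then show False using ab(3)[of \<phi>] by simp
    qed
    have "x \<preceq> y" "y \<preceq> x" using le[of x y] le[of y x] xy eq eq[symmetric] by blast+
    then show False using xy le_antisym by blast
  qed
  define S where "S = ?Q\<lparr>carrier := h ` C\<rparr>"
  have S: "carrier S = h ` C" "zero S = zero ?Q" "one S = one ?Q" "add S = add ?Q" "neg S = neg ?Q"
    "sup_op S = sup_op ?Q" "inf_op S = inf_op ?Q" "smul S = smul ?Q" "bigsup S = bigsup ?Q"
    unfolding S_def by simp_all
  have "bigsup S g f \<in> h ` C" if g: "g \<in> h ` C" and f: "range f \<subseteq> h ` C" for g f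
  proof -
    obtain g' where g': "g' \<in> C" "g = h g'" using g by blast
    \<comment> \<open>Preimages are chosen simultaneously for the whole sequence, so closure of the
      image follows from the homomorphism property.\<close>
    have "\<forall>n. \<exists>x. x \<in> C \<and> f n = h x" using f by blast
    then obtain f' where f': "\<And>n. f' n \<in> C" "\<And>n. f n = h (f' n)" by metis
    then have "f = (\<lambda>n. h (f' n))" by blast
    then have "bigsup S g f = h (bigsup G g' f')"
      using hom_bigsup[of g' f'] g' f' by (auto simp: S)
    then show ?thesis using g' f' by simp
  qed
  then have "closed_srs S"
    unfolding closed_srs_def S(1)
    by (auto simp: S simp flip: hom hom1 hom0)
  moreover have "h ` C \<subseteq> carrier ?Q"
    unfolding h_def quotient_srs_def power_srs_def by (auto intro: quotientI)
  ultimately have "subalgebra_srs S ?Q"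
    unfolding subalgebra_srs_def by (simp add: S)
  moreover have "iso_srs G S h"
    unfolding iso_srs_def hom_srs_def bij_betw_def
    using \<open>inj_on h C\<close> by (simp add: S hom hom1 hom0 hom_bigsup)
  ultimately show ?thesis using cong by blast
qed

end
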